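(* Let $I$ be an analytic ideal on $\omega$ such that the forcing $\mathcal{P}(\omega)/I$ does not add reals. Then $\mathcal{P}(\omega)/I$ adds an ultrafilter $U$ on $\omega$ with $(U,\supseteq)\geq_T(\omega^\omega,\leq)$; namely, if $G$ is $\mathcal{P}(\omega)/I$-generic, then $U=\{A\subseteq\omega: [A]_I\in G\}$ is such an ultrafilter.
   Context: $\mathcal{P}(\omega)/I$ is the quotient Boolean algebra (nonzero elements $[A]_I$ with $A\notin I$) used as a forcing. Tukey order: $P\le_T Q$ iff there is $f:Q\to P$ mapping cofinal subsets of $Q$ to cofinal subsets of $P$. $(\omega^\omega,\le)$ is ordered by everywhere domination. *)

theory Defs
  imports "HOL-Analysis.Analysis"
begin

section \<open>Analytic ideals on the natural numbers\<close>

text \<open>As usual for ideals on \<open>\<omega>\<close>, an ideal is proper and contains all finite sets.\<close>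

definition ideal_on_nat :: "nat set set \<Rightarrow> bool" where
  "ideal_on_nat I \<longleftrightarrow>
     (\<forall>A. finite A \<longrightarrow> A \<in> I) \<and> UNIV \<notin> I \<and>
     (\<forall>A B. A \<in> I \<longrightarrow> B \<subseteq> A \<longrightarrow> B \<in> I) \<and>
     (\<forall>A B. A \<in> I \<longrightarrow> B \<in> I \<longrightarrow> A \<union> B \<in> I)"

text \<open>\<open>\<P>(\<omega>)\<close> is identified with the Cantor space \<^typ>\<open>nat \<Rightarrow> bool\<close> by characteristic functions.
  The function types carry the product topology of the discrete spaces \<^typ>\<open>bool\<close> and \<^typ>\<open>nat\<close>.\<close>

definition analytic_family :: "nat set set \<Rightarrow> bool" where
  "analytic_family S \<longleftrightarrow>
     S = {} \<or>
     (\<exists>f :: (nat \<Rightarrow> nat) \<Rightarrow> (nat \<Rightarrow> bool).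
        continuous_on UNIV f \<and> range f = (\<lambda>A n. n \<in> A) ` S)"


section \<open>The forcing relation\<close>

text \<open>
  A forcing notion is a preorder \<open>R\<close> on \<open>Field R\<close>; \<open>(q, p) \<in> R\<close> means that \<open>q\<close> is stronger
  than \<open>p\<close>. A sentence of the forcing language is represented by the predicate
  ``\<open>p\<close> forces the sentence'', given by the usual recursive clauses over names in the ground
  model (which is the ambient universe). By the forcing theorem, a sentence holds in \<open>V[G]\<close>
  for every generic \<open>G\<close> iff every condition forces it.

  A name is a set of pairs (name of an element, condition). Elements \<open>x\<close> of a ground-model type
  serve as names of themselves. Thus a subset of \<open>\<omega>\<close> in \<open>V[G]\<close> has a name of type
  \<open>(nat, 'p) name\<close>, a binary relation on \<open>\<omega>\<close> (in particular a function) one of type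
  \<open>(nat \<times> nat, 'p) name\<close>, a set of subsets of \<open>\<omega>\<close> one of type \<open>((nat, 'p) name, 'p) name\<close>, and
  a set of ordered pairs of objects with names in \<open>'a\<close> and \<open>'b\<close> one of type
  \<open>('a \<times> 'b, 'p) name\<close>. Every subset of a ground-model set has such a (nice) name in \<open>V[G]\<close>,
  hence so does every set of (pairs of) objects of these kinds. So quantifying over all names of
  one of these types is quantifying over all objects of that kind in \<open>V[G]\<close>.
\<close>

type_synonym ('a, 'p) name = "('a \<times> 'p) set"

type_synonym 'p sentence = "'p \<Rightarrow> bool"

definition forced :: "'p rel \<Rightarrow> 'p sentence \<Rightarrow> bool" where
  "forced R \<phi> \<longleftrightarrow> (\<forall>p\<in>Field R. \<phi> p)"

text \<open>A statement about ground-model objects only, whose truth value does not depend on \<open>G\<close>.\<close>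

definition f_ground :: "bool \<Rightarrow> 'p sentence" where
  "f_ground b = (\<lambda>p. b)"

definition f_and :: "'p sentence \<Rightarrow> 'p sentence \<Rightarrow> 'p sentence"  (infixr \<open>\<^bold>\<and>\<close> 35) where
  "f_and \<phi> \<psi> = (\<lambda>p. \<phi> p \<and> \<psi> p)"

definition f_all :: "('a \<Rightarrow> 'p sentence) \<Rightarrow> 'p sentence"  (binder \<open>\<^bold>\<forall>\<close> 10) where
  "f_all \<Phi> = (\<lambda>p. \<forall>x. \<Phi> x p)"

definition f_not :: "'p rel \<Rightarrow> 'p sentence \<Rightarrow> 'p sentence" where
  "f_not R \<phi> = (\<lambda>p. \<forall>q. (q, p) \<in> R \<longrightarrow> \<not> \<phi> q)"

definition f_or :: "'p rel \<Rightarrow> 'p sentence \<Rightarrow> 'p sentence \<Rightarrow> 'p sentence" where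
  "f_or R \<phi> \<psi> = f_not R (f_not R \<phi> \<^bold>\<and> f_not R \<psi>)"

definition f_imp :: "'p rel \<Rightarrow> 'p sentence \<Rightarrow> 'p sentence \<Rightarrow> 'p sentence" where
  "f_imp R \<phi> \<psi> = f_not R (\<phi> \<^bold>\<and> f_not R \<psi>)"

definition f_iff :: "'p rel \<Rightarrow> 'p sentence \<Rightarrow> 'p sentence \<Rightarrow> 'p sentence" where
  "f_iff R \<phi> \<psi> = (f_imp R \<phi> \<psi> \<^bold>\<and> f_imp R \<psi> \<phi>)"

definition f_ex :: "'p rel \<Rightarrow> ('a \<Rightarrow> 'p sentence) \<Rightarrow> 'p sentence" where
  "f_ex R \<Phi> = f_not R (\<^bold>\<forall>x. f_not R (\<Phi> x))"

definition dense_below :: "'p rel \<Rightarrow> 'p set \<Rightarrow> 'p \<Rightarrow> bool" where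
  "dense_below R D p \<longleftrightarrow> (\<forall>q. (q, p) \<in> R \<longrightarrow> (\<exists>r\<in>D. (r, q) \<in> R))"

text \<open>\<open>f_mem R eq \<sigma> \<tau>\<close> is ``\<open>\<sigma> \<in> \<tau>\<close>'', where \<open>eq\<close> is the forcing relation for equality of
  objects of the kind of \<open>\<sigma>\<close>.\<close>

definition f_mem ::
  "'p rel \<Rightarrow> ('a \<Rightarrow> 'a \<Rightarrow> 'p sentence) \<Rightarrow> 'a \<Rightarrow> ('a, 'p) name \<Rightarrow> 'p sentence" where
  "f_mem R eq \<sigma> \<tau> = dense_below R {q. \<exists>(\<pi>, r)\<in>\<tau>. (q, r) \<in> R \<and> eq \<sigma> \<pi> q}"

definition f_set_eq ::
  "'p rel \<Rightarrow> ('a \<Rightarrow> 'a \<Rightarrow> 'p sentence) \<Rightarrow> ('a, 'p) name \<Rightarrow> ('a, 'p) name \<Rightarrow> 'p sentence" where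
  "f_set_eq R eq \<sigma> \<tau> = (\<^bold>\<forall>\<pi>. f_iff R (f_mem R eq \<pi> \<sigma>) (f_mem R eq \<pi> \<tau>))"

definition f_pair_eq ::
  "('a \<Rightarrow> 'a \<Rightarrow> 'p sentence) \<Rightarrow> ('b \<Rightarrow> 'b \<Rightarrow> 'p sentence) \<Rightarrow> 'a \<times> 'b \<Rightarrow> 'a \<times> 'b \<Rightarrow> 'p sentence" where
  "f_pair_eq eqa eqb s t = (eqa (fst s) (fst t) \<^bold>\<and> eqb (snd s) (snd t))"

text \<open>The instances for subsets of a ground-model type.\<close>

definition f_ground_eq :: "'a \<Rightarrow> 'a \<Rightarrow> 'p sentence" where
  "f_ground_eq x y = f_ground (x = y)"

abbreviation f_in :: "'p rel \<Rightarrow> 'a \<Rightarrow> ('a, 'p) name \<Rightarrow> 'p sentence" where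
  "f_in R \<equiv> f_mem R f_ground_eq"

abbreviation f_eq :: "'p rel \<Rightarrow> ('a, 'p) name \<Rightarrow> ('a, 'p) name \<Rightarrow> 'p sentence" where
  "f_eq R \<equiv> f_set_eq R f_ground_eq"

definition f_subset :: "'p rel \<Rightarrow> ('a, 'p) name \<Rightarrow> ('a, 'p) name \<Rightarrow> 'p sentence" where
  "f_subset R \<sigma> \<tau> = (\<^bold>\<forall>x. f_imp R (f_in R x \<sigma>) (f_in R x \<tau>))"

text \<open>Canonical names of a ground-model set, of a ground-model family of sets, and of the
  generic filter. No largest condition is assumed, hence all conditions are used.\<close>

definition check :: "'p rel \<Rightarrow> 'a set \<Rightarrow> ('a, 'p) name" where
  "check R A = A \<times> Field R"

definition check_family :: "'p rel \<Rightarrow> 'a set set \<Rightarrow> (('a, 'p) name, 'p) name" where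
  "check_family R \<A> = check R ` \<A> \<times> Field R"

definition generic_name :: "'p rel \<Rightarrow> ('p, 'p) name" where
  "generic_name R = {(p, p) | p. p \<in> Field R}"

text \<open>Reals are subsets of \<open>\<omega>\<close>: every one in \<open>V[G]\<close> equals some ground-model set \<open>A\<close>.\<close>

definition adds_no_reals :: "'p rel \<Rightarrow> bool" where
  "adds_no_reals R \<longleftrightarrow>
     forced R (\<^bold>\<forall>\<tau> :: (nat, 'p) name. f_ex R (\<lambda>A :: nat set. f_eq R \<tau> (check R A)))"


section \<open>Ultrafilters and the Tukey order in the generic extension\<close>

definition f_ultrafilter :: "'p rel \<Rightarrow> ((nat, 'p) name, 'p) name \<Rightarrow> 'p sentence" where
  "f_ultrafilter R u =
     (let mem = (\<lambda>x. f_mem R (f_eq R) x u) in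
        mem (check R UNIV)
        \<^bold>\<and> f_not R (mem (check R {}))
        \<^bold>\<and> (\<^bold>\<forall>x. \<^bold>\<forall>y. f_imp R (mem x \<^bold>\<and> f_subset R x y) (mem y))
        \<^bold>\<and> (\<^bold>\<forall>x. \<^bold>\<forall>y. \<^bold>\<forall>z.
              f_imp R (mem x \<^bold>\<and> mem y \<^bold>\<and> (\<^bold>\<forall>n. f_iff R (f_in R n z) (f_in R n x \<^bold>\<and> f_in R n y)))
                (mem z))
        \<^bold>\<and> (\<^bold>\<forall>x. \<^bold>\<forall>y.
              f_imp R (\<^bold>\<forall>n. f_iff R (f_in R n y) (f_not R (f_in R n x)))
                (f_or R (mem x) (mem y))))"

text \<open>``\<open>u\<close> does not belong to the ground model.''\<close>

definition f_new_family :: "'p rel \<Rightarrow> ((nat, 'p) name, 'p) name \<Rightarrow> 'p sentence" where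
  "f_new_family R u =
     (\<^bold>\<forall>\<A> :: nat set set. f_not R (f_set_eq R (f_eq R) u (check_family R \<A>)))"

definition f_baire :: "'p rel \<Rightarrow> (nat \<times> nat, 'p) name \<Rightarrow> 'p sentence" where
  "f_baire R g =
     (\<^bold>\<forall>m. f_ex R (\<lambda>n. f_in R (m, n) g \<^bold>\<and>
        (\<^bold>\<forall>k. f_imp R (f_in R (m, k) g) (f_ground (k = n)))))"

definition f_baire_le ::
  "'p rel \<Rightarrow> (nat \<times> nat, 'p) name \<Rightarrow> (nat \<times> nat, 'p) name \<Rightarrow> 'p sentence" where
  "f_baire_le R g h =
     (\<^bold>\<forall>m. \<^bold>\<forall>n. \<^bold>\<forall>k. f_imp R (f_in R (m, n) g \<^bold>\<and> f_in R (m, k) h) (f_ground (n \<le> k)))"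

text \<open>In the following, an ordered set of \<open>V[G]\<close> is given by the formulas \<open>D\<close> (membership)
  and \<open>le\<close>.\<close>

definition f_cofinal ::
  "'p rel \<Rightarrow> ('a \<Rightarrow> 'p sentence) \<Rightarrow> ('a \<Rightarrow> 'a \<Rightarrow> 'p sentence) \<Rightarrow> ('a \<Rightarrow> 'p sentence) \<Rightarrow> 'p sentence" where
  "f_cofinal R D le X =
     ((\<^bold>\<forall>x. f_imp R (X x) (D x)) \<^bold>\<and>
      (\<^bold>\<forall>d. f_imp R (D d) (f_ex R (\<lambda>x. X x \<^bold>\<and> le d x))))"

definition f_function ::
  "'p rel \<Rightarrow> ('a \<Rightarrow> 'a \<Rightarrow> 'p sentence) \<Rightarrow> ('b \<Rightarrow> 'b \<Rightarrow> 'p sentence) \<Rightarrow>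
   ('a \<Rightarrow> 'p sentence) \<Rightarrow> ('b \<Rightarrow> 'p sentence) \<Rightarrow> ('a \<times> 'b, 'p) name \<Rightarrow> 'p sentence" where
  "f_function R eqa eqb A B F =
     (let mem = (\<lambda>a b. f_mem R (f_pair_eq eqa eqb) (a, b) F) in
        (\<^bold>\<forall>a. \<^bold>\<forall>b. f_imp R (mem a b) (A a \<^bold>\<and> B b))
        \<^bold>\<and> (\<^bold>\<forall>a. f_imp R (A a) (f_ex R (\<lambda>b. mem a b)))
        \<^bold>\<and> (\<^bold>\<forall>a. \<^bold>\<forall>b. \<^bold>\<forall>c. f_imp R (mem a b \<^bold>\<and> mem a c) (eqb b c)))"

text \<open>\<open>(P, leP) \<le>\<^sub>T (Q, leQ)\<close>: some \<open>F : Q \<rightarrow> P\<close> maps every cofinal \<open>X \<subseteq> Q\<close> to a cofinal set.\<close>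

definition f_tukey_le ::
  "'p rel \<Rightarrow>
   ('b \<Rightarrow> 'b \<Rightarrow> 'p sentence) \<Rightarrow> ('b \<Rightarrow> 'p sentence) \<Rightarrow> ('b \<Rightarrow> 'b \<Rightarrow> 'p sentence) \<Rightarrow>
   ('a \<Rightarrow> 'a \<Rightarrow> 'p sentence) \<Rightarrow> ('a \<Rightarrow> 'p sentence) \<Rightarrow> ('a \<Rightarrow> 'a \<Rightarrow> 'p sentence) \<Rightarrow>
   'p sentence" where
  "f_tukey_le R eqP P leP eqQ Q leQ =
     f_ex R (\<lambda>F :: ('a \<times> 'b, 'p) name.
       f_function R eqQ eqP Q P F \<^bold>\<and>
       (\<^bold>\<forall>X :: ('a, 'p) name.
          f_imp R (f_cofinal R Q leQ (\<lambda>a. f_mem R eqQ a X))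
            (f_cofinal R P leP
               (\<lambda>b. f_ex R (\<lambda>a. f_mem R eqQ a X \<^bold>\<and> f_mem R (f_pair_eq eqQ eqP) (a, b) F)))))"

definition f_baire_tukey_le :: "'p rel \<Rightarrow> ((nat, 'p) name, 'p) name \<Rightarrow> 'p sentence" where
  "f_baire_tukey_le R u =
     f_tukey_le R
       (f_eq R) (f_baire R) (f_baire_le R)
       (f_eq R) (\<lambda>x. f_mem R (f_eq R) x u) (\<lambda>x y. f_subset R y x)"


section \<open>The forcing \<open>\<P>(\<omega>)/I\<close>\<close>

definition ideal_equiv :: "nat set set \<Rightarrow> nat set rel" where
  "ideal_equiv I = {(A, B). (A - B) \<union> (B - A) \<in> I}"

definition ideal_class :: "nat set set \<Rightarrow> nat set \<Rightarrow> nat set set" where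
  "ideal_class I A = ideal_equiv I `` {A}"

definition quotient_forcing :: "nat set set \<Rightarrow> nat set set rel" where
  "quotient_forcing I =
     {(ideal_class I A, ideal_class I B) | A B. A \<notin> I \<and> B \<notin> I \<and> A - B \<in> I}"

text \<open>The name of \<open>U = {A \<subseteq> \<omega>. [A]\<^sub>I \<in> G}\<close>. Here \<open>A\<close> ranges over the ground model, as \<open>[A]\<^sub>I\<close> has
  to be a condition.\<close>

definition generic_ultrafilter :: "nat set set \<Rightarrow> ((nat, nat set set) name, nat set set) name" where
  "generic_ultrafilter I =
     (let R = quotient_forcing I in
        {(check R A, p) | A p. p \<in> Field R \<and> f_in R (ideal_class I A) (generic_name R) p})"

end

theory Submission
  imports Defs
begin

text \<open>
  Since conditions are coded by reals, a forcing \<open>\<P>(\<omega>)/I\<close> without new reals is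
  \<open>\<omega>\<close>-distributive, and every name of a real is densely decided. Hence it suffices to find, below
  every positive set, a positive \<open>X\<close> and an antitone map \<open>f\<close> from the positive subsets of \<open>X\<close> to
  \<open>\<omega>\<^sup>\<omega>\<close> such that each \<open>g\<close> is below some \<open>f Y'\<close>, with \<open>Y'\<close> inside any prescribed positive
  \<open>Y \<subseteq> X\<close>.

  If there are \<open>C\<^sub>n \<in> I\<close> such that no positive subset of \<open>X\<close> is almost disjoint from all \<open>C\<^sub>n\<close>,
  then \<open>f A n = min (A - (C\<^sub>0 \<union> \<dots> \<union> C\<^sub>n))\<close> works. Otherwise the generic ultrafilter is a
  P-point. Consider the game in which the first player plays sets of the ultrafilter and, digit by
  digit, a witness \<open>x\<close> for membership in the analytic set \<open>I\<close>, and the second player plays finite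
  subsets of these sets, trying to make their union differ from what \<open>x\<close> witnesses. This game is open
  for the second player. A winning strategy of the first player and a pseudointersection of its
  countably many moves give a set of the ultrafilter that lies in \<open>I\<close>. So the second player wins,
  and the answers of the winning strategy show that \<open>I\<close> is \<open>F\<^sub>\<sigma>\<close> below some condition. There
  \<open>f A n\<close> is the first \<open>k\<close> at which \<open>A \<inter> k\<close> leaves the \<open>n\<close>-th closed piece of \<open>I\<close>.

  The same game with cofinite subsets of \<open>X\<close> in place of the ultrafilter splits \<open>X\<close> into two positive
  sets, so the forcing has no atoms and the ultrafilter is new.
\<close>

section \<open>Evaluating forced sentences\<close>

lemma f_andI: "\<phi> p \<Longrightarrow> \<psi> p \<Longrightarrow> (\<phi> \<^bold>\<and> \<psi>) p"
  by (simp add: f_and_def)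

lemma f_allI: "(\<And>x. \<Phi> x p) \<Longrightarrow> f_all \<Phi> p"
  by (simp add: f_all_def)

locale forcing =
  fixes R :: "'p rel"
  assumes refl: "p \<in> Field R \<Longrightarrow> (p, p) \<in> R"
    and trans: "(r, q) \<in> R \<Longrightarrow> (q, p) \<in> R \<Longrightarrow> (r, p) \<in> R"
begin

abbreviation stronger (infix "\<preceq>" 50) where
  "q \<preceq> p \<equiv> (q, p) \<in> R"

section \<open>Persistence of forced sentences under strengthening\<close>

definition persistent :: "'p sentence \<Rightarrow> bool" where
  "persistent \<phi> \<longleftrightarrow> (\<forall>p q. \<phi> p \<longrightarrow> q \<preceq> p \<longrightarrow> \<phi> q)"

lemma persistentD: "persistent \<phi> \<Longrightarrow> \<phi> p \<Longrightarrow> q \<preceq> p \<Longrightarrow> \<phi> q"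
  by (auto simp: persistent_def)

lemma f_imp_iff: "f_imp R \<phi> \<psi> p \<longleftrightarrow> (\<forall>q. q \<preceq> p \<longrightarrow> \<phi> q \<longrightarrow> (\<exists>r. r \<preceq> q \<and> \<psi> r))"
  by (auto simp: f_imp_def f_not_def f_and_def)

lemma f_ex_iff: "f_ex R \<Phi> p \<longleftrightarrow> (\<forall>q. q \<preceq> p \<longrightarrow> (\<exists>x r. r \<preceq> q \<and> \<Phi> x r))"
  by (auto simp: f_ex_def f_not_def f_all_def)

lemma f_or_iff:
  "f_or R \<phi> \<psi> p \<longleftrightarrow> (\<forall>q. q \<preceq> p \<longrightarrow> (\<exists>r. r \<preceq> q \<and> (\<phi> r \<or> \<psi> r)))"
  by (auto simp: f_or_def f_not_def f_and_def)

lemma f_mem_iff: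
  "f_mem R eq \<sigma> \<tau> p \<longleftrightarrow>
     (\<forall>q. q \<preceq> p \<longrightarrow> (\<exists>r \<pi> s. r \<preceq> q \<and> (\<pi>, s) \<in> \<tau> \<and> r \<preceq> s \<and> eq \<sigma> \<pi> r))"
  unfolding f_mem_def dense_below_def by fastforce

lemma f_in_iff:
  "f_in R n \<tau> p \<longleftrightarrow> (\<forall>q. q \<preceq> p \<longrightarrow> (\<exists>r s. r \<preceq> q \<and> (n, s) \<in> \<tau> \<and> r \<preceq> s))"
  unfolding f_mem_iff f_ground_eq_def f_ground_def by blast

lemma f_iff_iff: "f_iff R \<phi> \<psi> p \<longleftrightarrow> f_imp R \<phi> \<psi> p \<and> f_imp R \<psi> \<phi> p"
  by (simp add: f_iff_def f_and_def)

lemma persistent_mem: "persistent (f_mem R eq \<sigma> \<tau>)"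
  unfolding persistent_def f_mem_iff by (meson trans)

lemma persistent_not: "persistent (f_not R \<phi>)"
  unfolding persistent_def f_not_def by (meson trans)

lemma persistent_imp: "persistent (f_imp R \<phi> \<psi>)"
  unfolding f_imp_def by (rule persistent_not)

lemma persistent_ex: "persistent (f_ex R \<Phi>)"
  unfolding f_ex_def by (rule persistent_not)

lemma persistent_and: "persistent \<phi> \<Longrightarrow> persistent \<psi> \<Longrightarrow> persistent (\<phi> \<^bold>\<and> \<psi>)"
  by (auto simp: persistent_def f_and_def)

lemma persistent_all: "(\<And>x. persistent (\<Phi> x)) \<Longrightarrow> persistent (f_all \<Phi>)"
  by (auto simp: persistent_def f_all_def)

lemma persistent_iff: "persistent (f_iff R \<phi> \<psi>)"
  unfolding f_iff_def by (intro persistent_and persistent_imp)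

lemma persistent_eq: "persistent (f_set_eq R eq \<sigma> \<tau>)"
  unfolding f_set_eq_def by (intro persistent_all persistent_iff)

lemma persistent_subset: "persistent (f_subset R \<sigma> \<tau>)"
  unfolding f_subset_def by (intro persistent_all persistent_imp)

lemma persistent_baire: "persistent (f_baire R g)"
  unfolding f_baire_def by (intro persistent_all persistent_ex)

lemma persistent_baire_le: "persistent (f_baire_le R g h)"
  unfolding f_baire_le_def by (intro persistent_all persistent_imp)

lemma persistent_cofinal: "persistent (f_cofinal R D le X)"
  unfolding f_cofinal_def by (intro persistent_and persistent_all persistent_imp)

lemmas persistent_intros = persistent_mem persistent_not persistent_imp persistent_ex
  persistent_and persistent_all persistent_iff persistent_eq persistent_subset persistent_baire
  persistent_baire_le persistent_cofinal

text \<open>\<open>f_ex\<close> asks for witnesses densely below \<open>p\<close>; persistence lets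
  one witness at \<open>p\<close> serve every stronger condition.\<close>

lemma f_exI: "persistent (\<Phi> x) \<Longrightarrow> \<Phi> x p \<Longrightarrow> f_ex R \<Phi> p"
  unfolding f_ex_iff by (metis FieldI1 persistentD refl)

lemma f_in_dense: "(\<And>q. q \<preceq> p \<Longrightarrow> \<exists>r. r \<preceq> q \<and> f_in R n \<tau> r) \<Longrightarrow> f_in R n \<tau> p"
  unfolding f_in_iff by (meson FieldI1 refl trans)

text \<open>For a condition \<open>p\<close> this amounts to forcing \<open>x\<close> equal to
  \<open>check R A\<close>. Sentences about decided names turn into ground-model statements, which
  is how the forcing computations below are carried out.\<close>

definition decides :: "('a, 'p) name \<Rightarrow> 'a set \<Rightarrow> 'p sentence" where
  "decides x A p \<longleftrightarrow> (\<forall>n\<in>A. f_in R n x p) \<and> (\<forall>n. n \<notin> A \<longrightarrow> f_not R (f_in R n x) p)"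

lemma persistent_decides: "persistent (decides x A)"
  unfolding persistent_def decides_def by (meson persistentD persistent_mem persistent_not)

lemmas decides_mono = persistentD[OF persistent_decides]

lemma f_in_decided: "decides x A p \<Longrightarrow> p \<in> Field R \<Longrightarrow> f_in R n x p \<longleftrightarrow> n \<in> A"
  unfolding decides_def f_not_def by (metis refl)

lemma decides_check: "decides (check R A) A p"
  unfolding decides_def f_not_def
proof (intro conjI ballI allI impI notI)
  fix n assume "n \<in> A"
  then show "f_in R n (check R A) p"
    unfolding f_in_iff check_def by (metis FieldI1 mem_Sigma_iff refl)
next
  fix n q assume "n \<notin> A" "q \<preceq> p" "f_in R n (check R A) q"
  then show False
    unfolding f_in_iff check_def by (metis FieldI1 mem_Sigma_iff refl)
qed

lemma f_in_decided_below: "decides x A p \<Longrightarrow> q \<preceq> p \<Longrightarrow> f_in R n x q \<longleftrightarrow> n \<in> A"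
  by (meson FieldI1 decides_mono f_in_decided)

lemma f_imp_in_decided:
  assumes "decides x A p" "decides y B p" "p \<in> Field R"
  shows "f_imp R (f_in R m x) (f_in R n y) p \<longleftrightarrow> (m \<in> A \<longrightarrow> n \<in> B)"
  unfolding f_imp_iff
  using f_in_decided_below[OF assms(1)] f_in_decided_below[OF assms(2)] assms(3)
  by (metis FieldI1 refl trans)

lemma f_eq_decided:
  assumes "decides x A p" "decides y B p" "p \<in> Field R"
  shows "f_eq R x y p \<longleftrightarrow> A = B"
  unfolding f_set_eq_def f_all_def f_iff_iff
    f_imp_in_decided[OF assms] f_imp_in_decided[OF assms(2,1,3)] by blast

lemma f_subset_decided:
  assumes "decides x A p" "decides y B p" "p \<in> Field R"
  shows "f_subset R x y p \<longleftrightarrow> A \<subseteq> B"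
  unfolding f_subset_def f_all_def f_imp_in_decided[OF assms] by blast

text \<open>Membership of pairs is already fixed at \<open>p\<close>, so the witnesses for totality
  and uniqueness found below \<open>p\<close> are facts about \<open>G\<close> itself.\<close>

lemma f_baire_decided:
  assumes "decides g G p" "p \<in> Field R"
  shows "f_baire R g p \<longleftrightarrow> (\<exists>\<phi>. G = range (\<lambda>m. (m, \<phi> m)))"
proof
  assume g: "f_baire R g p"
  have "\<exists>!n. (m, n) \<in> G" for m
  proof -
    obtain n r where r: "r \<preceq> p" "f_in R (m, n) g r"
      "\<And>k. f_imp R (f_in R (m, k) g) (f_ground (k = n)) r"
      using g assms(2) unfolding f_baire_def f_all_def f_ex_iff f_and_def by (meson refl)
    have "(m, n) \<in> G"
      using f_in_decided_below[OF assms(1) r(1)] r(2) by blast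
    moreover have "k = n" if "(m, k) \<in> G" for k
    proof -
      have "f_in R (m, k) g r" using f_in_decided_below[OF assms(1) r(1)] that by blast
      then show ?thesis using r(3)[of k] r(1) unfolding f_imp_iff f_ground_def
        by (meson FieldI1 refl)
    qed
    ultimately show ?thesis by blast
  qed
  then have "\<forall>m. \<exists>c. \<forall>n. (m, n) \<in> G \<longleftrightarrow> n = c" by blast
  from choice[OF this] obtain \<phi> where "\<forall>m n. (m, n) \<in> G \<longleftrightarrow> n = \<phi> m" by blast
  then have "G = range (\<lambda>m. (m, \<phi> m))" by auto
  then show "\<exists>\<phi>. G = range (\<lambda>m. (m, \<phi> m))" by blast
next
  assume "\<exists>\<phi>. G = range (\<lambda>m. (m, \<phi> m))"
  then obtain \<phi> where G: "G = range (\<lambda>m. (m, \<phi> m))" ..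
  have "f_ex R (\<lambda>n. f_in R (m, n) g \<^bold>\<and> (\<^bold>\<forall>k. f_imp R (f_in R (m, k) g) (f_ground (k = n)))) p"
    for m
  proof (rule f_exI[where x="\<phi> m"])
    show "persistent (f_in R (m, \<phi> m) g \<^bold>\<and> (\<^bold>\<forall>k. f_imp R (f_in R (m, k) g) (f_ground (k = \<phi> m))))"
      by (intro persistent_intros)
    have "f_imp R (f_in R (m, k) g) (f_ground (k = \<phi> m)) p" for k
      unfolding f_imp_iff f_ground_def
    proof (intro allI impI)
      fix q assume q: "q \<preceq> p" "f_in R (m, k) g q"
      then have "k = \<phi> m" using f_in_decided_below[OF assms(1) q(1)] G by auto
      then show "\<exists>r. r \<preceq> q \<and> k = \<phi> m" using q(1) by (meson FieldI1 refl)
    qed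
    moreover have "f_in R (m, \<phi> m) g p"
      using f_in_decided[OF assms] G by blast
    ultimately show "(f_in R (m, \<phi> m) g \<^bold>\<and>
        (\<^bold>\<forall>k. f_imp R (f_in R (m, k) g) (f_ground (k = \<phi> m)))) p"
      by (simp add: f_and_def f_all_def)
  qed
  then show "f_baire R g p"
    by (simp add: f_baire_def f_all_def)
qed

lemma f_baire_le_decided:
  assumes "decides g (range (\<lambda>m. (m, \<phi> m))) p" "decides h (range (\<lambda>m. (m, \<psi> m))) p"
    and "\<And>m. \<phi> m \<le> \<psi> m"
  shows "f_baire_le R g h p"
  unfolding f_baire_le_def f_all_def f_imp_iff f_and_def f_ground_def
proof (intro allI impI)
  fix m n k q
  assume q: "q \<preceq> p" "f_in R (m, n) g q \<and> f_in R (m, k) h q"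
  then have "n \<le> k"
    using f_in_decided_below[OF assms(1) q(1)] f_in_decided_below[OF assms(2) q(1)] assms(3)
    by auto
  then show "\<exists>r. r \<preceq> q \<and> n \<le> k" using q(1) by (meson FieldI1 refl)
qed

end

section \<open>Deciding names of reals\<close>

locale forcing_no_reals = forcing +
  assumes no_reals: "adds_no_reals R"
begin

lemma ex_decides_nat:
  fixes x :: "(nat, 'a) name"
  assumes "p \<in> Field R"
  shows "\<exists>q A. q \<preceq> p \<and> decides x A q"
proof -
  obtain A q where q: "q \<preceq> p" "f_eq R x (check R A) q"
    using no_reals assms unfolding adds_no_reals_def forced_def f_all_def f_ex_iff by (meson refl)
  have *: "f_imp R (f_in R n x) (f_in R n (check R A)) q"
    "f_imp R (f_in R n (check R A)) (f_in R n x) q" for n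
    using q(2) by (auto simp: f_set_eq_def f_all_def f_iff_iff)
  note chk = f_in_decided_below[OF decides_check[of A]]
  \<comment> \<open>The implication only gives membership at some condition below each one, so
    positive membership is recovered by density.\<close>
  have "f_in R n x q" if "n \<in> A" for n
    using *(2)[of n] that chk unfolding f_imp_iff by (intro f_in_dense) blast
  moreover have "f_not R (f_in R n x) q" if "n \<notin> A" for n
    using *(1)[of n] that chk unfolding f_imp_iff f_not_def by blast
  ultimately have "decides x A q" by (auto simp: decides_def)
  with q(1) show ?thesis by blast
qed

text \<open>Coding the countable type into \<omega> reduces this to subsets of \<omega>. It will be
  applied to names of functions and of countable sequences of sets.\<close>

lemma ex_decides:
  fixes x :: "('b::countable, 'a) name"
  assumes "p \<in> Field R"
  shows "\<exists>q A. q \<preceq> p \<and> decides x A q"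
proof -
  define y where "y = {(to_nat m, r) | m r. (m, r) \<in> x}"
  have y: "f_in R (to_nat m) y = f_in R m x" for m
    by (rule ext) (auto simp: f_in_iff y_def)
  obtain q A where "q \<preceq> p" "decides y A q"
    using ex_decides_nat[OF assms] by blast
  then have "decides x {m. to_nat m \<in> A} q"
    unfolding decides_def using y by fastforce
  with \<open>q \<preceq> p\<close> show ?thesis by blast
qed

end

section \<open>The unfolded game\<close>

lemma tendsto_coordinatewise:
  fixes f :: "'b \<Rightarrow> 'i \<Rightarrow> 'a::topological_space"
  shows "(f \<longlongrightarrow> l) F \<longleftrightarrow> (\<forall>i. ((\<lambda>c. f c i) \<longlongrightarrow> l i) F)"
  using limitin_componentwise[of "\<lambda>_. euclidean" UNIV f l F]
  by (simp add: euclidean_product_topology)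

text \<open>Falsity of a coordinate is an open condition. Otherwise points agreeing with
  \<open>x\<close> on longer and longer initial segments would converge to \<open>x\<close> while
  coordinate \<open>i\<close> stays true.\<close>

lemma continuous_cylinder:
  fixes h :: "(nat \<Rightarrow> nat) \<Rightarrow> nat \<Rightarrow> bool"
  assumes "continuous_on UNIV h" "\<not> h x i"
  obtains m where "\<And>y. (\<forall>j<m. y j = x j) \<Longrightarrow> \<not> h y i"
proof (rule ccontr)
  assume "\<not> thesis"
  then have "\<exists>y. (\<forall>j<m. y j = x j) \<and> h y i" for m using that by blast
  then obtain y where y: "\<And>m j. j < m \<Longrightarrow> y m j = x j" "\<And>m. h (y m) i" by metis
  have "(\<lambda>m. y m j) \<longlonglongrightarrow> x j" for j
    by (rule tendsto_eventually) (use y(1) in \<open>auto simp: eventually_sequentially intro: exI[of _ "Suc j"]\<close>)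
  then have "y \<longlonglongrightarrow> x"
    by (simp add: tendsto_coordinatewise)
  then have "(\<lambda>m. h (y m)) \<longlonglongrightarrow> h x"
    by (rule continuous_on_tendsto_compose[OF assms(1)]) auto
  then have "(\<lambda>m. h (y m) i) \<longlonglongrightarrow> h x i"
    by (simp add: tendsto_coordinatewise)
  then show False using y(2) assms(2) by (simp add: tendsto_discrete)
qed

text \<open>In both uses \<open>h\<close> enumerates the ideal and the members of
  \<open>\<P>\<close> are positive. \<open>almost_distributive\<close> joins distributivity with the
  existence of pseudointersections. \<open>uncovered\<close> admits two witnesses because one
  evading play takes care of only every other block of a set.\<close>

locale unfolded_game =
  fixes h :: "(nat \<Rightarrow> nat) \<Rightarrow> nat \<Rightarrow> bool" and \<P> :: "nat set set"
  assumes cont: "continuous_on UNIV h"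
    and finite_removal: "Y \<in> \<P> \<Longrightarrow> finite F \<Longrightarrow> Y - F \<in> \<P>"
    and almost_distributive: "X \<in> \<P> \<Longrightarrow>
      (\<And>n Y. Y \<in> \<P> \<Longrightarrow> Y \<subseteq> X \<Longrightarrow> \<exists>Z\<in>\<P>. Z \<subseteq> Y \<and> Z \<in> O' n) \<Longrightarrow>
      \<exists>Z\<in>\<P>. Z \<subseteq> X \<and> (\<forall>n::nat. \<exists>Y\<in>O' n. finite (Z - Y))"
    and uncovered: "Y \<in> \<P> \<Longrightarrow> finite F \<Longrightarrow> \<not> Y \<subseteq> F \<union> {i. h x i} \<union> {i. h y i}"
begin

section \<open>Positions of the game and answers of the second player\<close>

abbreviation extends :: "(nat \<Rightarrow> nat) \<Rightarrow> nat list \<Rightarrow> bool" where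
  "extends x u \<equiv> (\<forall>j<length u. x j = u ! j)"

lemma extends_snoc: "extends x u \<Longrightarrow> extends x (u @ [x (length u)])"
  by (auto simp: nth_append less_Suc_eq)

lemma inter_mem: "Y \<in> \<P> \<Longrightarrow> finite (Y - Z) \<Longrightarrow> Y \<inter> Z \<in> \<P>"
  using finite_removal[of Y "Y - Z"] by (simp add: Diff_Diff_Int)

lemma almost_distributive_countable:
  fixes O' :: "'i::countable \<Rightarrow> nat set set"
  assumes "X \<in> \<P>" "\<And>n Y. Y \<in> \<P> \<Longrightarrow> Y \<subseteq> X \<Longrightarrow> \<exists>Z\<in>\<P>. Z \<subseteq> Y \<and> Z \<in> O' n"
  shows "\<exists>Z\<in>\<P>. Z \<subseteq> X \<and> (\<forall>n. \<exists>Y\<in>O' n. finite (Z - Y))"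
  using almost_distributive[OF assms(1), of "\<lambda>n. O' (from_nat n)"] assms(2)
  by (metis from_nat_to_nat)

text \<open>For \<open>\<P> = I\<^sup>+\<close> this is the game of the generic extension, seen from the ground model:
  \<open>wins X u E\<close> says that \<open>X\<close> forces the second player to win from the position where the digits \<open>u\<close>
  of the witness and finite sets with union \<open>E\<close> have been played. The first player's set is
  represented by a condition \<open>Y\<close> below it, and \<open>Z\<close> is a condition deciding the answer \<open>s\<close>.\<close>

inductive wins :: "nat set \<Rightarrow> nat list \<Rightarrow> nat set \<Rightarrow> bool" where
  wins_now: "(\<And>y. extends y u \<Longrightarrow> \<exists>i\<in>E. \<not> h y i) \<Longrightarrow> wins X u E"
| wins_step: "(\<And>k Y. Y \<in> \<P> \<Longrightarrow> Y \<subseteq> X \<Longrightarrow>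
      \<exists>Z\<in>\<P>. Z \<subseteq> Y \<and> (\<exists>s. finite s \<and> s \<subseteq> Y \<and> wins Z (u @ [k]) (E \<union> s))) \<Longrightarrow> wins X u E"

lemma wins_mono:
  assumes "wins X u E" "Y \<subseteq> X"
  shows "wins Y u E"
  using assms(1)
proof cases
  case wins_now
  then show ?thesis by (rule wins.wins_now)
next
  case wins_step
  show ?thesis
    by (rule wins.wins_step, rule wins_step) (use assms(2) in auto)
qed

text \<open>A winning position of the second player yields countably many families of finite sets: the
  answers to the possible moves. Every set of \<open>\<P>\<close> contains an answer from each family, while a
  set containing an answer from each family lets the second player defeat every witness \<open>x\<close>.\<close>

definition answers :: "nat set \<Rightarrow> nat list \<Rightarrow> nat set \<Rightarrow> nat set set set \<Rightarrow> bool" where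
  "answers Z u E \<SS> \<longleftrightarrow> countable \<SS> \<and> (\<forall>\<S>\<in>\<SS>. \<forall>s\<in>\<S>. finite s) \<and>
     (\<forall>\<S>\<in>\<SS>. \<forall>Y\<in>\<P>. Y \<subseteq> Z \<longrightarrow> (\<exists>s\<in>\<S>. s \<subseteq> Y)) \<and>
     (\<forall>Y x. E \<subseteq> Y \<longrightarrow> extends x u \<longrightarrow> (\<forall>\<S>\<in>\<SS>. \<exists>s\<in>\<S>. s \<subseteq> Y) \<longrightarrow> (\<exists>i\<in>Y. \<not> h x i))"

lemma
  assumes "answers Z u E \<SS>"
  shows answers_countable: "countable \<SS>"
    and answers_finite: "\<S> \<in> \<SS> \<Longrightarrow> s \<in> \<S> \<Longrightarrow> finite s"
    and answers_meet: "\<S> \<in> \<SS> \<Longrightarrow> Y \<in> \<P> \<Longrightarrow> Y \<subseteq> Z \<Longrightarrow> \<exists>s\<in>\<S>. s \<subseteq> Y"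
    and answers_defeat: "E \<subseteq> Y \<Longrightarrow> extends x u \<Longrightarrow> (\<And>\<S>. \<S> \<in> \<SS> \<Longrightarrow> \<exists>s\<in>\<S>. s \<subseteq> Y) \<Longrightarrow>
      \<exists>i\<in>Y. \<not> h x i"
  using assms by (simp_all add: answers_def)

text \<open>Only the meeting clause mentions \<open>Z\<close>. A \<open>W\<close> almost inside
  \<open>Z\<close> can be shrunk to \<open>W \<inter> Z\<close>, which stays in
  \<open>\<P>\<close>.\<close>

lemma answers_mono:
  assumes "answers Z u E \<SS>" "finite (Y - Z)"
  shows "answers Y u E \<SS>"
proof -
  have "\<exists>s\<in>\<S>. s \<subseteq> W" if "\<S> \<in> \<SS>" "W \<in> \<P>" "W \<subseteq> Y" for \<S> W
  proof -
    have "W - Z \<subseteq> Y - Z" using that(3) by blast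
    then have "W \<inter> Z \<in> \<P>" using that(2) assms(2) inter_mem finite_subset by metis
    then show ?thesis using answers_meet[OF assms(1) that(1)] by (metis inf.bounded_iff inf_le2)
  qed
  then show ?thesis using assms(1) by (simp add: answers_def)
qed

text \<open>By induction on the winning position. The families are, for each digit, the usable
  answers to it, together with all families belonging to the positions after such an answer. One
  pseudointersection settles the usability of all finite answers at once.\<close>

lemma wins_answers:
  assumes "wins X u E" "X \<in> \<P>"
  shows "\<exists>Z\<in>\<P>. Z \<subseteq> X \<and> (\<exists>\<SS>. answers Z u E \<SS>)"
  using assms
proof (induction rule: wins.induct)
  case (wins_now u E X)
  have "\<exists>i\<in>Y. \<not> h x i" if "E \<subseteq> Y" "extends x u" for Y x
    using wins_now.hyps[OF that(2)] that(1) by blast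
  then have "answers X u E {}" by (simp add: answers_def)
  with wins_now.prems show ?case by blast
next
  case (wins_step X u E)
  define good where "good Z k s \<longleftrightarrow> (\<exists>\<SS>. answers Z (u @ [k]) (E \<union> s) \<SS>)" for Z k s
  have good_mono: "good Z k s \<Longrightarrow> finite (Y - Z) \<Longrightarrow> good Y k s" for Z Y k s
    unfolding good_def using answers_mono by blast
  have step: "\<exists>Z\<in>\<P>. Z \<subseteq> Y \<and> (\<exists>s. finite s \<and> s \<subseteq> Y \<and> good Z k s)"
    if "Y \<in> \<P>" "Y \<subseteq> X" for k Y
    using wins_step.IH[OF that, of k] unfolding good_def by (meson order_trans)
  \<comment> \<open>Sets deciding \<open>good\<close> are trivially dense. Coding finite answers by
    lists makes the index type countable.\<close>
  define O' where "O' = (\<lambda>(k, l). {Y \<in> \<P>. good Y k (set l) \<or> (\<forall>Y'\<in>\<P>. Y' \<subseteq> Y \<longrightarrow> \<not> good Y' k (set l))})"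
  have "\<exists>Z\<in>\<P>. Z \<subseteq> Y \<and> Z \<in> O' n" if "Y \<in> \<P>" for n Y
    using that by (cases n) (auto simp: O'_def)
  then obtain Z where Z: "Z \<in> \<P>" "Z \<subseteq> X" "\<And>n. \<exists>Y\<in>O' n. finite (Z - Y)"
    using almost_distributive_countable[OF wins_step.prems, of O'] by metis
  \<comment> \<open>If \<open>good\<close> holds somewhere below \<open>Z\<close>, the deciding set
    \<open>Y\<close> cannot refute it. So it holds at \<open>Y\<close>, and then at
    \<open>Z\<close>, which is almost inside \<open>Y\<close>.\<close>
  have dec: "good Z k s" if "finite s" "Z' \<in> \<P>" "Z' \<subseteq> Z" "good Z' k s" for k s Z'
  proof -
    obtain l where l: "s = set l" using \<open>finite s\<close> finite_list by blast
    obtain Y where Y: "Y \<in> \<P>" "finite (Z - Y)"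
      "good Y k s \<or> (\<forall>Y'\<in>\<P>. Y' \<subseteq> Y \<longrightarrow> \<not> good Y' k s)"
      using Z(3)[of "(k, l)"] unfolding O'_def l by auto
    have "Z' - Y \<subseteq> Z - Y" using that by blast
    then have "Z' \<inter> Y \<in> \<P>" using inter_mem Y(2) finite_subset that(2) by metis
    moreover have "good (Z' \<inter> Y) k s" using good_mono[OF that(4)] by (simp add: Diff_eq)
    ultimately have "good Y k s" using Y(3) by blast
    then show ?thesis using good_mono Y(2) by blast
  qed
  define \<S> where "\<S> k = {s. finite s \<and> good Z k s}" for k
  obtain f where f: "\<And>k s. s \<in> \<S> k \<Longrightarrow> answers Z (u @ [k]) (E \<union> s) (f k s)"
  proof -
    have "\<forall>k s. \<exists>\<T>. s \<in> \<S> k \<longrightarrow> answers Z (u @ [k]) (E \<union> s) \<T>"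
      by (auto simp: \<S>_def good_def)
    then show ?thesis using that by metis
  qed
  define \<SS> where "\<SS> = range \<S> \<union> (\<Union>k. \<Union>s\<in>\<S> k. f k s)"
  have \<SS>_cases: "(\<exists>k. \<T> = \<S> k) \<or> (\<exists>k t. t \<in> \<S> k \<and> \<T> \<in> f k t)" if "\<T> \<in> \<SS>" for \<T>
    using that unfolding \<SS>_def by blast
  have "answers Z u E \<SS>"
    unfolding answers_def
  proof (intro conjI ballI allI impI)
    have "countable (\<S> k)" for k
      by (rule countable_subset[OF _ countable_Collect_finite]) (auto simp: \<S>_def)
    then show "countable \<SS>"
      unfolding \<SS>_def using answers_countable[OF f] by auto
    show "finite s" if "\<T> \<in> \<SS>" "s \<in> \<T>" for \<T> s
      using \<SS>_cases[OF that(1)] that(2) answers_finite[OF f] unfolding \<S>_def by blast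
    show "\<exists>s\<in>\<T>. s \<subseteq> Y" if \<T>: "\<T> \<in> \<SS>" and Y: "Y \<in> \<P>" "Y \<subseteq> Z" for \<T> Y
    proof -
      have "\<exists>s\<in>\<S> k. s \<subseteq> Y" for k
      proof -
        obtain Z' s where "Z' \<in> \<P>" "Z' \<subseteq> Y" "finite s" "s \<subseteq> Y" "good Z' k s"
          using step[of Y k] Y Z(2) by (metis order_trans)
        moreover from this have "good Z k s" using dec Y(2) by (metis order_trans)
        ultimately show ?thesis unfolding \<S>_def by blast
      qed
      then show ?thesis
        using \<SS>_cases[OF \<T>] answers_meet[OF f _ Y] by blast
    qed
    show "\<exists>i\<in>Y. \<not> h x i" if Y: "E \<subseteq> Y" "extends x u" "\<forall>\<T>\<in>\<SS>. \<exists>s\<in>\<T>. s \<subseteq> Y" for Y x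
    proof -
      \<comment> \<open>Follow the witness \<open>x\<close>: its next digit selects the family from
        which \<open>Y\<close> contains an answer \<open>s\<close>, and the families after
        \<open>s\<close> defeat \<open>x\<close>.\<close>
      let ?k = "x (length u)"
      have "\<S> ?k \<in> \<SS>" by (simp add: \<SS>_def)
      then obtain s where s: "s \<in> \<S> ?k" "s \<subseteq> Y" using Y(3) by blast
      have "\<T> \<in> \<SS>" if "\<T> \<in> f ?k s" for \<T>
        using that s(1) unfolding \<SS>_def by blast
      then show ?thesis
        using answers_defeat[OF f[OF s(1)] _ extends_snoc[OF Y(2)]] Y s(2) by simp
    qed
  qed
  then show ?case using Z by blast
qed

text \<open>\<open>D\<close> and \<open>\<kappa>\<close> are a strategy of the first player on
  \<open>bad\<close> positions. The second player answers with alternate blocks of \<open>Z\<close>;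
  the interval skipped before each block puts the block inside the set that \<open>D\<close> assigns
  to the current position. The digits played form \<open>x\<close>, which is true on all blocks
  because every position reached is consistent with some witness.\<close>

lemma witness_of_play:
  assumes start: "bad [] {}"
    and step: "\<And>u E s. bad u E \<Longrightarrow> finite s \<Longrightarrow> s \<subseteq> D u E \<Longrightarrow> bad (u @ [\<kappa> u E]) (E \<union> s)"
    and alive: "\<And>u E. bad u E \<Longrightarrow> \<exists>y. extends y u \<and> (\<forall>i\<in>E. h y i)"
    and n: "strict_mono n"
    and gap: "\<And>j E u. E \<subseteq> {..<n j} \<Longrightarrow> set u \<subseteq> {..<n j} \<Longrightarrow> length u \<le> n j \<Longrightarrow>
      Z \<inter> {n (Suc j)..} \<subseteq> D u E \<and> \<kappa> u E < n (Suc j)"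
  shows "\<exists>x. \<forall>j. \<forall>i \<in> Z \<inter> {n (2 * j + 1)..<n (2 * j + 2)}. h x i"
proof -
  define W where "W j = Z \<inter> {n (2 * j + 1)..<n (2 * j + 2)}" for j
  define pos where "pos = rec_nat ([], {}) (\<lambda>j (u, E). (u @ [\<kappa> u E], E \<union> W j))"
  define x where "x j = (case pos j of (u, E) \<Rightarrow> \<kappa> u E)" for j
  have pos_0: "pos 0 = ([], {})" by (simp add: pos_def)
  have pos_Suc: "pos (Suc j) = (fst (pos j) @ [x j], snd (pos j) \<union> W j)" for j
    by (simp add: pos_def x_def split_beta)
  have inv: "bad (fst (pos j)) (snd (pos j)) \<and> length (fst (pos j)) = j \<and>
      set (fst (pos j)) \<subseteq> {..<n (2 * j)} \<and> snd (pos j) \<subseteq> {..<n (2 * j)}" for j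
  proof (induction j)
    case 0
    show ?case using start by (simp add: pos_0)
  next
    case (Suc j)
    have "j \<le> n (2 * j)" using strict_mono_imp_increasing[OF n, of "2 * j"] by simp
    then have g: "Z \<inter> {n (2 * j + 1)..} \<subseteq> D (fst (pos j)) (snd (pos j))" "x j < n (2 * j + 1)"
      using gap[of "snd (pos j)" "2 * j" "fst (pos j)"] Suc by (auto simp: x_def split_beta)
    have "bad (fst (pos j) @ [x j]) (snd (pos j) \<union> W j)"
    proof -
      have "W j \<subseteq> D (fst (pos j)) (snd (pos j))" "finite (W j)"
        using g(1) by (auto simp: W_def)
      then show ?thesis
        using step[of "fst (pos j)" "snd (pos j)" "W j"] Suc by (auto simp: x_def split_beta)
    qed
    moreover have "n (2 * j) < n (2 * j + 1)" "n (2 * j + 1) < n (2 * Suc j)"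
      using n by (auto simp: strict_mono_def)
    ultimately show ?case
      using Suc g(2) unfolding pos_Suc by (auto simp: W_def)
  qed
  have fst_pos: "fst (pos j) = map x [0..<j]" for j
    by (induction j) (auto simp: pos_0 pos_Suc)
  have snd_pos: "W j \<subseteq> snd (pos k)" if "j < k" for j k
    using that by (induction k) (auto simp: pos_Suc less_Suc_eq)
  have "h x i" if i: "i \<in> W j" for i j
  proof (rule ccontr)
    assume "\<not> h x i"
    then obtain m where m: "\<And>y. (\<forall>j<m. y j = x j) \<Longrightarrow> \<not> h y i"
      using continuous_cylinder[OF cont] by metis
    \<comment> \<open>Late enough that the first \<open>m\<close> digits and the block of
      \<open>i\<close> have been played. A witness consistent with this position contradicts the
      choice of \<open>m\<close>.\<close>
    define k where "k = max m (Suc j)"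
    obtain y where y: "extends y (fst (pos k))" "\<forall>i\<in>snd (pos k). h y i"
      using alive inv by blast
    have "\<forall>j<m. y j = x j" using y(1) unfolding fst_pos k_def by auto
    moreover have "j < k" by (simp add: k_def)
    then have "h y i" using y(2) snd_pos[of j k] i by blast
    ultimately show False using m by blast
  qed
  then show ?thesis unfolding W_def by blast
qed

text \<open>Two plays against the same strategy, the second with the sequence \<open>n\<close>
  shifted by one, cover complementary blocks of \<open>Z\<close>. Only the part below
  \<open>n 1\<close> is left over.\<close>

lemma covered_if_evading:
  assumes start: "bad [] {}"
    and step: "\<And>u E s. bad u E \<Longrightarrow> finite s \<Longrightarrow> s \<subseteq> D u E \<Longrightarrow> bad (u @ [\<kappa> u E]) (E \<union> s)"
    and alive: "\<And>u E. bad u E \<Longrightarrow> \<exists>y. extends y u \<and> (\<forall>i\<in>E. h y i)"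
    and almost: "\<And>u E. finite (Z - D u E)"
  shows "\<exists>F x y. finite F \<and> Z \<subseteq> F \<union> {i. h x i} \<union> {i. h y i}"
proof -
  \<comment> \<open>There are only finitely many positions bounded by \<open>a\<close>, so every
    sufficiently large \<open>b\<close> works.\<close>
  define ok where "ok a b \<longleftrightarrow> (\<forall>(u, E) \<in> {u. set u \<subseteq> {..<a} \<and> length u \<le> a} \<times> Pow {..<a}.
      Z \<inter> {b..} \<subseteq> D u E \<and> \<kappa> u E < b)" for a b :: nat
  have "\<exists>b>a. ok a b" for a
  proof -
    have "eventually (\<lambda>b. Z \<inter> {b..} \<subseteq> D u E \<and> \<kappa> u E < b) sequentially" for u E
    proof -
      obtain c where "Z - D u E \<subseteq> {..<c}"
        using almost finite_nat_iff_bounded by metis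
      then have "\<forall>b\<ge>max c (Suc (\<kappa> u E)). Z \<inter> {b..} \<subseteq> D u E \<and> \<kappa> u E < b"
        by fastforce
      then show ?thesis unfolding eventually_sequentially by blast
    qed
    then have "eventually (ok a) sequentially"
      unfolding ok_def
      by (intro eventually_ball_finite finite_cartesian_product finite_lists_length_le) auto
    then have "eventually (\<lambda>b. b > a \<and> ok a b) sequentially"
      by (intro eventually_conj eventually_gt_at_top)
    then show ?thesis using eventually_happens by fastforce
  qed
  then obtain g where g: "\<And>a. a < g a" "\<And>a. ok a (g a)" by metis
  define n where "n j = (g ^^ j) 0" for j
  have n_Suc: "n (Suc j) = g (n j)" for j by (simp add: n_def)
  have mono: "strict_mono n" by (simp add: strict_mono_Suc_iff n_Suc g(1))
  have gap: "Z \<inter> {n (Suc j)..} \<subseteq> D u E \<and> \<kappa> u E < n (Suc j)"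
    if "E \<subseteq> {..<n j}" "set u \<subseteq> {..<n j}" "length u \<le> n j" for j E u
    using g(2)[of "n j"] that unfolding ok_def n_Suc by blast
  have "\<exists>x. \<forall>j. \<forall>i \<in> Z \<inter> {n (2 * j + 1)..<n (2 * j + 2)}. h x i"
    using start step alive mono gap by (rule witness_of_play[of bad D \<kappa> n Z])
  then obtain x where x: "\<forall>j. \<forall>i \<in> Z \<inter> {n (2 * j + 1)..<n (2 * j + 2)}. h x i" ..
  have mono': "strict_mono (\<lambda>j. n (Suc j))" using mono by (simp add: strict_mono_Suc_iff)
  have "\<exists>y. \<forall>j. \<forall>i \<in> Z \<inter> {n (Suc (2 * j + 1))..<n (Suc (2 * j + 2))}. h y i"
    using start step alive mono' gap by (rule witness_of_play[of bad D \<kappa> "\<lambda>j. n (Suc j)" Z])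
  then obtain y where y: "\<forall>j. \<forall>i \<in> Z \<inter> {n (Suc (2 * j + 1))..<n (Suc (2 * j + 2))}. h y i" ..
  have "i \<in> {..<n 1} \<union> {i. h x i} \<union> {i. h y i}" if "i \<in> Z" for i
  proof (cases "i < n 1")
    case False
    define j where "j = (LEAST j. i < n j)"
    have "i < n (Suc i)" using strict_mono_imp_increasing[OF mono, of "Suc i"] by simp
    then have j: "i < n j" "\<And>k. k < j \<Longrightarrow> n k \<le> i"
      unfolding j_def by (auto intro: LeastI dest: not_less_Least)
    have "j \<ge> 2"
    proof (rule ccontr)
      assume "\<not> j \<ge> 2"
      then have "n j \<le> n 1" using strict_mono_less_eq[OF mono, of j 1] by linarith
      then show False using j(1) False by linarith
    qed
    \<comment> \<open>Counted from the block that starts at \<open>n 1\<close>, blocks of even index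
      belong to \<open>x\<close> and those of odd index to \<open>y\<close>.\<close>
    then obtain k where "j = Suc (Suc k)" by (metis add_2_eq_Suc le_Suc_ex)
    then have k: "i \<in> Z \<inter> {n (Suc k)..<n (Suc (Suc k))}"
      using j(1) j(2)[of "Suc k"] that by simp
    show ?thesis
    proof (cases "even k")
      case True
      then obtain l where "k = 2 * l" by blast
      then show ?thesis using k x[rule_format, of i l] by simp
    next
      case False
      then obtain l where "k = Suc (2 * l)" by (metis oddE Suc_eq_plus1)
      then show ?thesis using k y[rule_format, of i l] by simp
    qed
  qed simp
  then show ?thesis by (meson finite_lessThan subsetI)
qed

text \<open>Determinacy of an open game, carried out inside \<open>\<P>\<close>. If the second
  player wins nowhere below \<open>X\<close>, a pseudointersection \<open>Z\<close> yields a
  strategy of the first player, and \<open>covered_if_evading\<close> contradicts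
  \<open>uncovered\<close>.\<close>

theorem ex_answers:
  assumes "X \<in> \<P>"
  shows "\<exists>Z\<in>\<P>. Z \<subseteq> X \<and> (\<exists>\<SS>. answers Z [] {} \<SS>)"
proof (cases "\<exists>X'\<in>\<P>. X' \<subseteq> X \<and> wins X' [] {}")
  case True
  then show ?thesis using wins_answers by (meson order_trans)
next
  case False
  define safe where "safe Y u E k \<longleftrightarrow>
    (\<forall>Z\<in>\<P>. Z \<subseteq> Y \<longrightarrow> (\<forall>s. finite s \<longrightarrow> s \<subseteq> Y \<longrightarrow> \<not> wins Z (u @ [k]) (E \<union> s)))" for Y u E k
  define O' where "O' = (\<lambda>(u, l). {Y \<in> \<P>. wins Y u (set l) \<or> (\<exists>k. safe Y u (set l) k)})"
  \<comment> \<open>The contrapositive of \<open>wins_step\<close>: if \<open>wins\<close> fails at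
    \<open>Y\<close>, some digit and some smaller set are safe against every answer.\<close>
  have "\<exists>Z\<in>\<P>. Z \<subseteq> Y \<and> Z \<in> O' n" if "Y \<in> \<P>" for n Y
  proof (cases n)
    case (Pair u l)
    show ?thesis
    proof (cases "wins Y u (set l)")
      case True
      then show ?thesis using that by (auto simp: O'_def Pair)
    next
      case False
      then show ?thesis using wins_step[of Y u "set l"] unfolding O'_def Pair safe_def
        by (simp, meson)
    qed
  qed
  then obtain Z where Z: "Z \<in> \<P>" "Z \<subseteq> X" "\<And>n. \<exists>Y\<in>O' n. finite (Z - Y)"
    using almost_distributive_countable[OF assms, of O'] by metis
  \<comment> \<open>The quantifier over all \<open>Z'\<close> below \<open>Z\<close> allows passing
    to \<open>Z' \<inter> Y\<close> for the sets \<open>Y\<close> from \<open>O'\<close>, in both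
    directions.\<close>
  define bad where "bad u E \<longleftrightarrow> finite E \<and> (\<forall>Z'\<in>\<P>. Z' \<subseteq> Z \<longrightarrow> \<not> wins Z' u E)" for u E
  have "\<exists>Y k. finite (Z - Y) \<and> (bad u E \<longrightarrow> (\<forall>s. finite s \<longrightarrow> s \<subseteq> Y \<longrightarrow> bad (u @ [k]) (E \<union> s)))" for u E
  proof (cases "bad u E")
    case True
    then obtain l where l: "E = set l" using finite_list bad_def by blast
    obtain Y where Y: "Y \<in> \<P>" "finite (Z - Y)" "wins Y u E \<or> (\<exists>k. safe Y u E k)"
      using Z(3)[of "(u, l)"] unfolding O'_def l by auto
    have inter: "Z' \<inter> Y \<in> \<P>" if "Z' \<in> \<P>" "Z' \<subseteq> Z" for Z'
    proof -
      have "Z' - Y \<subseteq> Z - Y" using that by blast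
      then show ?thesis using inter_mem Y(2) finite_subset that(1) by metis
    qed
    have "\<not> wins Y u E"
      using True wins_mono[of Y u E "Z \<inter> Y"] inter[OF Z(1)] unfolding bad_def by blast
    then obtain k where k: "safe Y u E k" using Y(3) by blast
    have "bad (u @ [k]) (E \<union> s)" if "finite s" "s \<subseteq> Y" for s
      unfolding bad_def
    proof (intro conjI ballI impI notI)
      show "finite (E \<union> s)" using that l by simp
      fix Z' assume Z': "Z' \<in> \<P>" "Z' \<subseteq> Z" "wins Z' (u @ [k]) (E \<union> s)"
      have "wins (Z' \<inter> Y) (u @ [k]) (E \<union> s)" using wins_mono[OF Z'(3)] by blast
      moreover have "\<not> wins (Z' \<inter> Y) (u @ [k]) (E \<union> s)"
        using k inter[OF Z'(1,2)] that unfolding safe_def by simp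
      ultimately show False by blast
    qed
    then show ?thesis using Y(2) by blast
  next
    case False
    \<comment> \<open>Default move \<open>Y = Z\<close> with an arbitrary digit.\<close>
    then show ?thesis by (metis Diff_cancel finite.emptyI)
  qed
  then obtain D \<kappa> where D: "\<And>u E. finite (Z - D u E)"
    "\<And>u E s. bad u E \<Longrightarrow> finite s \<Longrightarrow> s \<subseteq> D u E \<Longrightarrow> bad (u @ [\<kappa> u E]) (E \<union> s)"
    by metis
  have start: "bad [] {}" using False Z(2) unfolding bad_def by (meson finite.emptyI order_trans)
  have alive: "\<exists>y. extends y u \<and> (\<forall>i\<in>E. h y i)" if "bad u E" for u E
    using that Z(1) wins_now[of u E Z] unfolding bad_def by blast
  have "\<exists>F x y. finite F \<and> Z \<subseteq> F \<union> {i. h x i} \<union> {i. h y i}"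
    using start D(2) alive D(1) by (rule covered_if_evading[of bad D \<kappa> Z])
  then show ?thesis using uncovered[OF Z(1)] by blast
qed

end

section \<open>Closed hereditary families\<close>

definition hereditary :: "nat set set \<Rightarrow> bool" where
  "hereditary \<K> \<longleftrightarrow> (\<forall>A B. A \<in> \<K> \<longrightarrow> B \<subseteq> A \<longrightarrow> B \<in> \<K>)"

text \<open>For hereditary families this is closedness in the Cantor space, since the initial
  segments of a limit are initial segments of members.\<close>

definition finitely_determined :: "nat set set \<Rightarrow> bool" where
  "finitely_determined \<K> \<longleftrightarrow> (\<forall>Y. (\<forall>k. Y \<inter> {..<k} \<in> \<K>) \<longrightarrow> Y \<in> \<K>)"

lemma hereditaryD: "hereditary \<K> \<Longrightarrow> A \<in> \<K> \<Longrightarrow> B \<subseteq> A \<Longrightarrow> B \<in> \<K>"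
  by (auto simp: hereditary_def)

text \<open>Compactness of the Cantor space. The infinite index sets \<open>N k\<close> are thinned
  out one coordinate at a time, and \<open>B\<close> records the values kept.\<close>

lemma cluster_set:
  fixes A :: "nat \<Rightarrow> nat set"
  obtains B where "\<And>k. \<exists>j\<ge>k. A j \<inter> {..<k} = B \<inter> {..<k}"
proof -
  define N where "N = rec_nat UNIV
    (\<lambda>k M. if infinite {j\<in>M. k \<in> A j} then {j\<in>M. k \<in> A j} else {j\<in>M. k \<notin> A j})"
  define B where "B = {k. infinite {j\<in>N k. k \<in> A j}}"
  have N_0: "N 0 = UNIV" by (simp add: N_def)
  have N_Suc: "N (Suc k) = (if k \<in> B then {j\<in>N k. k \<in> A j} else {j\<in>N k. k \<notin> A j})" for k
    by (simp add: N_def B_def)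
  have inf: "infinite (N k)" for k
  proof (induction k)
    case (Suc k)
    have "N k = {j\<in>N k. k \<in> A j} \<union> {j\<in>N k. k \<notin> A j}" by blast
    then have "infinite {j\<in>N k. k \<in> A j} \<or> infinite {j\<in>N k. k \<notin> A j}"
      using Suc finite_UnI by metis
    then show ?case unfolding N_Suc by (auto simp: B_def)
  qed (simp add: N_0)
  have agree: "i \<in> A j \<longleftrightarrow> i \<in> B" if "j \<in> N k" "i < k" for i j k
    using that by (induction k) (auto simp: N_Suc less_Suc_eq split: if_splits)
  have "\<exists>j\<ge>k. A j \<inter> {..<k} = B \<inter> {..<k}" for k
  proof -
    obtain j where "j \<ge> k" "j \<in> N k" using inf[of k] infinite_nat_iff_unbounded_le by blast
    then show ?thesis using agree[of j k] by (intro exI[of _ j]) auto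
  qed
  then show thesis by (rule that)
qed

text \<open>Cut \<open>Y\<close> along a cluster point \<open>B\<close> of the left summands: each
  initial segment of \<open>Y \<inter> B\<close> lies in a left summand, and each one of
  \<open>Y - B\<close> in a right summand.\<close>

lemma finitely_determined_joins:
  assumes "hereditary \<K>" "finitely_determined \<K>"
  shows "finitely_determined {E \<union> F | E F. E \<in> \<K> \<and> F \<in> \<K>}"
  unfolding finitely_determined_def
proof (intro allI impI)
  fix Y assume "\<forall>k. Y \<inter> {..<k} \<in> {E \<union> F | E F. E \<in> \<K> \<and> F \<in> \<K>}"
  then have "\<forall>k. \<exists>E F. Y \<inter> {..<k} = E \<union> F \<and> E \<in> \<K> \<and> F \<in> \<K>" by blast
  then obtain E F where EF: "\<And>k. Y \<inter> {..<k} = E k \<union> F k" "\<And>k. E k \<in> \<K>" "\<And>k. F k \<in> \<K>"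
    by metis
  obtain B where B: "\<And>k. \<exists>j\<ge>k. E j \<inter> {..<k} = B \<inter> {..<k}" using cluster_set[of E] by blast
  have "Y \<inter> B \<inter> {..<k} \<in> \<K> \<and> (Y - B) \<inter> {..<k} \<in> \<K>" for k
  proof -
    obtain j where j: "j \<ge> k" "E j \<inter> {..<k} = B \<inter> {..<k}" using B by blast
    have "Y \<inter> B \<inter> {..<k} \<subseteq> E j" using j(2) by blast
    moreover have "(Y - B) \<inter> {..<k} \<subseteq> F j" using j EF(1)[of j] by fastforce
    ultimately show ?thesis using hereditaryD[OF assms(1)] EF(2,3) by blast
  qed
  then have "Y \<inter> B \<in> \<K>" "Y - B \<in> \<K>" using assms(2) unfolding finitely_determined_def by blast+
  moreover have "Y = (Y \<inter> B) \<union> (Y - B)" by blast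
  ultimately show "Y \<in> {E \<union> F | E F. E \<in> \<K> \<and> F \<in> \<K>}" by blast
qed

text \<open>Failures persist to longer initial segments by heredity, so two separate failures give
  one segment outside both families.\<close>

lemma finitely_determined_Un:
  assumes "hereditary \<K>" "finitely_determined \<K>" "hereditary \<L>" "finitely_determined \<L>"
  shows "finitely_determined (\<K> \<union> \<L>)"
  unfolding finitely_determined_def
proof (intro allI impI, rule ccontr)
  fix Y assume Y: "\<forall>k. Y \<inter> {..<k} \<in> \<K> \<union> \<L>" "Y \<notin> \<K> \<union> \<L>"
  then obtain k l where "Y \<inter> {..<k} \<notin> \<K>" "Y \<inter> {..<l} \<notin> \<L>"
    using assms(2,4) unfolding finitely_determined_def by blast
  moreover have "Y \<inter> {..<k} \<subseteq> Y \<inter> {..<max k l}" "Y \<inter> {..<l} \<subseteq> Y \<inter> {..<max k l}" by auto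
  ultimately show False using Y(1) hereditaryD[OF assms(1)] hereditaryD[OF assms(3)] by blast
qed

text \<open>Rearranges the pieces into an increasing sequence in which members of one stage unite
  inside the next. Starting from sets with at most one point, every finite set is reached, and
  adding a point costs one stage.\<close>

primrec tower :: "(nat \<Rightarrow> nat set set) \<Rightarrow> nat \<Rightarrow> nat set set" where
  "tower \<K> 0 = {E. \<exists>x. E \<subseteq> {x}}"
| "tower \<K> (Suc n) = {E \<union> F | E F. E \<in> tower \<K> n \<union> \<K> n \<and> F \<in> tower \<K> n \<union> \<K> n}"

lemma hereditary_joins: "hereditary \<K> \<Longrightarrow> hereditary {E \<union> F | E F. E \<in> \<K> \<and> F \<in> \<K>}"
proof (unfold hereditary_def, intro allI impI)
  fix A B assume K: "\<forall>A B. A \<in> \<K> \<longrightarrow> B \<subseteq> A \<longrightarrow> B \<in> \<K>"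
    and A: "A \<in> {E \<union> F | E F. E \<in> \<K> \<and> F \<in> \<K>}" and B: "B \<subseteq> A"
  from A obtain E F where "A = E \<union> F" "E \<in> \<K>" "F \<in> \<K>" by blast
  then have "B = (B \<inter> E) \<union> (B \<inter> F)" "B \<inter> E \<in> \<K>" "B \<inter> F \<in> \<K>" using K B by auto
  then show "B \<in> {E \<union> F | E F. E \<in> \<K> \<and> F \<in> \<K>}" by blast
qed

lemma hereditary_Un: "hereditary \<K> \<Longrightarrow> hereditary \<L> \<Longrightarrow> hereditary (\<K> \<union> \<L>)"
  unfolding hereditary_def by blast

lemma hereditary_tower: "(\<And>n. hereditary (\<K> n)) \<Longrightarrow> hereditary (tower \<K> n)"
proof (induction n)
  case 0
  show ?case by (auto simp: hereditary_def)
next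
  case (Suc n)
  then show ?case using hereditary_joins[OF hereditary_Un[of "tower \<K> n" "\<K> n"]] by simp
qed

lemma finitely_determined_tower:
  assumes "\<And>n. hereditary (\<K> n)" "\<And>n. finitely_determined (\<K> n)"
  shows "finitely_determined (tower \<K> n)"
proof (induction n)
  case 0
  show ?case unfolding finitely_determined_def
  proof (intro allI impI)
    fix Y assume Y: "\<forall>k. Y \<inter> {..<k} \<in> tower \<K> 0"
    have "a = b" if "a \<in> Y" "b \<in> Y" for a b
    proof -
      obtain x where "Y \<inter> {..<Suc (max a b)} \<subseteq> {x}" using Y by auto
      moreover have "a \<in> Y \<inter> {..<Suc (max a b)}" "b \<in> Y \<inter> {..<Suc (max a b)}"
        using that by auto
      ultimately show ?thesis by blast
    qed
    then have "\<exists>x. Y \<subseteq> {x}" by (cases "Y = {}") blast+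
    then show "Y \<in> tower \<K> 0" by simp
  qed
next
  case (Suc n)
  have "hereditary (tower \<K> n \<union> \<K> n)"
    by (intro hereditary_Un hereditary_tower assms)
  moreover have "finitely_determined (tower \<K> n \<union> \<K> n)"
    by (intro finitely_determined_Un hereditary_tower assms Suc)
  ultimately show ?case unfolding tower.simps by (rule finitely_determined_joins)
qed

lemma tower_Suc: "tower \<K> n \<subseteq> tower \<K> (Suc n)"
proof
  fix E assume "E \<in> tower \<K> n"
  moreover have "E = E \<union> E" by blast
  ultimately show "E \<in> tower \<K> (Suc n)" unfolding tower.simps by blast
qed

lemma base_tower: "\<K> n \<subseteq> tower \<K> (Suc n)"
proof
  fix E assume "E \<in> \<K> n"
  moreover have "E = E \<union> E" by blast
  ultimately show "E \<in> tower \<K> (Suc n)" unfolding tower.simps by blast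
qed

text \<open>\<open>Y'\<close> is a union of finite sets \<open>S\<close>. To leave
  \<open>T j\<close>, append to \<open>S\<close> a piece \<open>t\<close> of a far tail of
  \<open>Y\<close> that only just leaves \<open>T N\<close>. Then \<open>S \<union> t\<close> is in
  \<open>T (Suc (Suc N))\<close>, which settles the constraints of larger index, and the tail begins
  beyond \<open>g n\<close> for the other ones.\<close>

lemma slow_subset:
  fixes T :: "nat \<Rightarrow> nat set set"
  assumes her: "\<And>n. hereditary (T n)" and fd: "\<And>n. finitely_determined (T n)"
    and Suc: "\<And>n. T n \<subseteq> T (Suc n)" and single: "\<And>x. {x} \<in> T 0"
    and join: "\<And>n E F. E \<in> T n \<Longrightarrow> F \<in> T n \<Longrightarrow> E \<union> F \<in> T (Suc n)"
    and Y: "\<And>n. Y \<notin> T n"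
  shows "\<exists>Y'\<subseteq>Y. (\<forall>n. Y' \<notin> T n) \<and> (\<forall>n. Y' \<inter> {..<g n} \<in> T n)"
proof -
  have mono: "T n \<subseteq> T m" if "n \<le> m" for n m using lift_Suc_mono_le[of T] Suc that by blast
  have empty: "{} \<in> T n" for n
    using mono[of 0 n] hereditaryD[OF her single[of 0], of "{}"] by auto
  have fin: "\<exists>n. S \<in> T n" if "finite S" for S
    using that
  proof (induction S)
    case empty
    then show ?case using \<open>{} \<in> T 0\<close> by blast
  next
    case (insert x S)
    then obtain n where "S \<in> T n" by blast
    moreover have "{x} \<in> T n" using single mono[of 0 n] by auto
    ultimately show ?case using join[of "{x}" n S] by auto
  qed
  \<comment> \<open>The removed finite part lies in some stage, and joining it back would put
    \<open>Y\<close> into a later one.\<close>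
  have tail: "Y - {..<m} \<notin> T n" for m n
  proof
    assume A: "Y - {..<m} \<in> T n"
    obtain k where "{..<m} \<in> T k" using fin by blast
    then have "(Y - {..<m}) \<union> {..<m} \<in> T (Suc (max n k))"
      using A mono[of n "max n k"] mono[of k "max n k"] by (intro join) auto
    then have "Y \<in> T (Suc (max n k))" by (rule hereditaryD[OF her]) blast
    then show False using Y by blast
  qed
  define inv where "inv S \<longleftrightarrow> finite S \<and> S \<subseteq> Y \<and> (\<forall>n. S \<inter> {..<g n} \<in> T n)" for S
  have "\<exists>S'. inv S' \<and> (S \<subseteq> S' \<and> S' \<notin> T j)" if S: "inv S" for S j
  proof -
    obtain N where N: "S \<in> T N" "j \<le> N"
    proof -
      obtain N where "S \<in> T N" using fin S inv_def by blast
      then have "S \<in> T (max j N)" using mono[of N "max j N"] by auto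
      then show thesis using that by simp
    qed
    define m where "m = Max (g ` {..Suc (Suc N)})"
    have m: "g n \<le> m" if "n \<le> Suc (Suc N)" for n using that by (simp add: m_def)
    define k where "k = (LEAST k. (Y - {..<m}) \<inter> {..<k} \<notin> T N)"
    define t where "t = (Y - {..<m}) \<inter> {..<k}"
    have "\<exists>k. (Y - {..<m}) \<inter> {..<k} \<notin> T N"
      using fd[of N] tail unfolding finitely_determined_def by blast
    then have t: "t \<notin> T N" unfolding t_def k_def by (rule LeastI_ex)
    have "k \<noteq> 0"
    proof
      assume "k = 0"
      then have "t = {}" by (simp add: t_def)
      then show False using t empty by simp
    qed
    then have "k - 1 < k" by simp
    \<comment> \<open>By minimality of \<open>k\<close>, dropping the point \<open>k - 1\<close>
      falls back into \<open>T N\<close>; restoring it costs one stage.\<close>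
    then have t': "(Y - {..<m}) \<inter> {..<k - 1} \<in> T N" unfolding k_def using not_less_Least by blast
    have "t \<subseteq> (Y - {..<m}) \<inter> {..<k - 1} \<union> {k - 1}" by (auto simp: t_def)
    moreover have "{k - 1} \<in> T N" using single mono[of 0 N] by auto
    ultimately have "t \<in> T (Suc N)" using hereditaryD[OF her join[OF t']] by blast
    then have S': "S \<union> t \<in> T (Suc (Suc N))" using N(1) Suc[of N] by (intro join) auto
    have "(S \<union> t) \<inter> {..<g n} \<in> T n" for n
    proof (cases "n \<le> Suc (Suc N)")
      case True
      then have "(S \<union> t) \<inter> {..<g n} = S \<inter> {..<g n}" using m[of n] by (auto simp: t_def)
      then show ?thesis using S by (simp add: inv_def)
    next
      case False
      then have "S \<union> t \<in> T n" using S' mono[of "Suc (Suc N)" n] by auto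
      then show ?thesis by (rule hereditaryD[OF her]) blast
    qed
    then have "inv (S \<union> t)" using S by (auto simp: inv_def t_def)
    moreover have "S \<union> t \<notin> T j"
    proof
      assume "S \<union> t \<in> T j"
      then have "t \<in> T j" by (rule hereditaryD[OF her]) blast
      then show False using t mono[OF N(2)] by blast
    qed
    ultimately show ?thesis by blast
  qed
  moreover have "inv {}" by (simp add: inv_def empty)
  ultimately obtain S where S: "\<And>j. inv (S j)" "\<And>j. S j \<subseteq> S (Suc j)" "\<And>j. S (Suc j) \<notin> T j"
    using dependent_nat_choice[of "\<lambda>_. inv" "\<lambda>j S S'. S \<subseteq> S' \<and> S' \<notin> T j"] by metis
  have S_mono: "S i \<subseteq> S j" if "i \<le> j" for i j using lift_Suc_mono_le[of S] S(2) that by blast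
  have "(\<Union>j. S j) \<inter> {..<g n} \<in> T n" for n
  proof -
    have "\<exists>j. A \<subseteq> S j" if "finite A" "A \<subseteq> (\<Union>j. S j)" for A
      using that
    proof (induction A)
      case (insert x A)
      then obtain i j where "x \<in> S i" "A \<subseteq> S j" by auto
      then have "insert x A \<subseteq> S (max i j)" using S_mono[of i "max i j"] S_mono[of j "max i j"] by auto
      then show ?case by blast
    qed simp
    then obtain j where "(\<Union>j. S j) \<inter> {..<g n} \<subseteq> S j"
      by (metis finite_Int finite_lessThan inf_le1)
    then have "(\<Union>j. S j) \<inter> {..<g n} \<subseteq> S j \<inter> {..<g n}" by blast
    moreover have "S j \<inter> {..<g n} \<in> T n" using S(1)[of j] by (simp add: inv_def)
    ultimately show ?thesis using hereditaryD[OF her] by metis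
  qed
  moreover have "(\<Union>j. S j) \<notin> T n" for n
    using hereditaryD[OF her, of "\<Union>j. S j" n "S (Suc n)"] S(3)[of n] by blast
  moreover have "(\<Union>j. S j) \<subseteq> Y" using S(1) by (auto simp: inv_def)
  ultimately show ?thesis by blast
qed

section \<open>Analytic ideals\<close>

locale nat_ideal =
  fixes I :: "nat set set"
  assumes ideal: "ideal_on_nat I"
begin

lemma finite_mem: "finite A \<Longrightarrow> A \<in> I"
  using ideal by (simp add: ideal_on_nat_def)

lemma subset_mem: "A \<in> I \<Longrightarrow> B \<subseteq> A \<Longrightarrow> B \<in> I"
  using ideal unfolding ideal_on_nat_def by blast

lemma Un_mem: "A \<in> I \<Longrightarrow> B \<in> I \<Longrightarrow> A \<union> B \<in> I"
  using ideal unfolding ideal_on_nat_def by blast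

lemma subset_Un_mem: "A \<in> I \<Longrightarrow> B \<in> I \<Longrightarrow> C \<subseteq> A \<union> B \<Longrightarrow> C \<in> I"
  using Un_mem subset_mem by blast

text \<open>\<open>f\<close> will be the restriction of a Tukey map from the generic ultrafilter to \<open>\<omega>\<^sup>\<omega>\<close>
  to the sets below the condition \<open>X\<close>.\<close>

definition tukey_map_below :: "nat set \<Rightarrow> (nat set \<Rightarrow> nat \<Rightarrow> nat) \<Rightarrow> bool" where
  "tukey_map_below X f \<longleftrightarrow>
     (\<forall>A B. A \<subseteq> B \<longrightarrow> B \<subseteq> X \<longrightarrow> A \<notin> I \<longrightarrow> f B \<le> f A) \<and>
     (\<forall>Y g. Y \<subseteq> X \<longrightarrow> Y \<notin> I \<longrightarrow> (\<exists>Y'\<subseteq>Y. Y' \<notin> I \<and> g \<le> f Y'))"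

text \<open>To dominate \<open>g\<close>, discard from \<open>Y\<close> the points that are too
  small for it. The discarded set is almost disjoint from every \<open>C m\<close>, so
  \<open>no\<close> puts it into \<open>I\<close>.\<close>

lemma tukey_map_if_not_p_point:
  assumes C: "\<And>n. C n \<in> I"
    and no: "\<And>Y. Y \<subseteq> X \<Longrightarrow> Y \<notin> I \<Longrightarrow> \<exists>n::nat. infinite (Y \<inter> C n)"
  shows "\<exists>f. tukey_map_below X f"
proof -
  define D where "D n = (\<Union>i\<le>n. C i)" for n
  have D: "D n \<in> I" for n
  proof (induction n)
    case (Suc n)
    have "D (Suc n) = D n \<union> C (Suc n)" by (auto simp: D_def atMost_Suc)
    then show ?case using Suc C Un_mem by simp
  qed (use C in \<open>simp add: D_def\<close>)
  have D_mono: "D m \<subseteq> D n" if "m \<le> n" for m n using that by (force simp: D_def)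
  have least: "(LEAST i. i \<in> A - D n) \<in> A - D n" if "A \<notin> I" for A n
  proof -
    have "A - D n \<noteq> {}" using that D[of n] subset_mem by blast
    then show ?thesis by (metis LeastI_ex ex_in_conv)
  qed
  define f where "f A n = (LEAST i. i \<in> A - D n)" for A n
  have "f B \<le> f A" if "A \<subseteq> B" "A \<notin> I" for A B
  proof (rule le_funI)
    fix n
    have "f A n \<in> B - D n" using least[OF that(2), of n] that(1) unfolding f_def by blast
    then show "f B n \<le> f A n" unfolding f_def[of B] by (rule Least_le)
  qed
  moreover have "\<exists>Y'\<subseteq>Y. Y' \<notin> I \<and> g \<le> f Y'" if Y: "Y \<subseteq> X" "Y \<notin> I" for Y g
  proof -
    define Y' where "Y' = {y\<in>Y. \<forall>n. y \<notin> D n \<longrightarrow> g n \<le> y}"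
    have "finite ((Y - Y') \<inter> C m)" for m
    proof -
      \<comment> \<open>A point of \<open>C m\<close> belongs to \<open>D n\<close> for all
        \<open>n \<ge> m\<close>, so it can only be discarded on account of some
        \<open>n < m\<close>.\<close>
      have "(Y - Y') \<inter> C m \<subseteq> (\<Union>n<m. {..<g n})"
      proof
        fix y assume y: "y \<in> (Y - Y') \<inter> C m"
        then obtain n where n: "y \<notin> D n" "y < g n" by (auto simp: Y'_def not_le)
        have "y \<in> D m" using y by (auto simp: D_def)
        then have "n < m" using n(1) D_mono[of m n] by (meson leI subsetD)
        then show "y \<in> (\<Union>n<m. {..<g n})" using n(2) by blast
      qed
      then show ?thesis by (rule finite_subset) simp
    qed
    then have "Y - Y' \<in> I" using no[of "Y - Y'"] Y(1) by blast
    then have "Y' \<notin> I" using subset_Un_mem[of Y' "Y - Y'" Y] Y(2) by blast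
    moreover have "g \<le> f Y'"
      using least[OF \<open>Y' \<notin> I\<close>] by (intro le_funI) (auto simp: f_def Y'_def)
    moreover have "Y' \<subseteq> Y" by (auto simp: Y'_def)
    ultimately show ?thesis by blast
  qed
  ultimately have "tukey_map_below X f" unfolding tukey_map_below_def by blast
  then show ?thesis by blast
qed

text \<open>The time at which a set leaves \<open>T n\<close> is finite for positive sets by
  closedness, and no later for larger sets by heredity. \<open>slow_subset\<close> delays these
  times beyond any given \<open>g\<close>.\<close>

lemma tukey_map_if_fsigma:
  assumes her: "\<And>n. hereditary (K n)" and fd: "\<And>n. finitely_determined (K n)"
    and K: "\<And>n. K n \<subseteq> I" and cover: "\<And>Y. Y \<subseteq> X \<Longrightarrow> Y \<in> I \<Longrightarrow> \<exists>n::nat. Y \<in> K n"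
  shows "\<exists>f. tukey_map_below X f"
proof -
  define T where "T = tower K"
  have T_her: "hereditary (T n)" and T_fd: "finitely_determined (T n)" for n
    unfolding T_def using her fd by (auto intro: hereditary_tower finitely_determined_tower)
  have T_I: "T n \<subseteq> I" for n
    unfolding T_def
  proof (induction n)
    case 0
    show ?case by (auto intro: finite_mem finite_subset)
  next
    case (Suc n)
    then show ?case using K[of n] Un_mem by fastforce
  qed
  have T_cover: "\<exists>n. Y \<in> T n" if "Y \<subseteq> X" "Y \<in> I" for Y
    using cover[OF that] base_tower[of K] unfolding T_def by blast
  define f where "f A n = (LEAST k. A \<inter> {..<k} \<notin> T n)" for A n
  have least: "A \<inter> {..<f A n} \<notin> T n" if "A \<notin> I" for A n
  proof -
    have "\<exists>k. A \<inter> {..<k} \<notin> T n"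
      using that T_fd[of n] T_I[of n] unfolding finitely_determined_def by blast
    then show ?thesis unfolding f_def by (rule LeastI_ex)
  qed
  have "f B \<le> f A" if "A \<subseteq> B" "A \<notin> I" for A B
  proof (rule le_funI)
    fix n
    have "B \<inter> {..<f A n} \<notin> T n"
      using least[OF that(2), of n] hereditaryD[OF T_her] that(1) by (meson Int_mono order_refl)
    then show "f B n \<le> f A n" unfolding f_def[of B] by (rule Least_le)
  qed
  moreover have "\<exists>Y'\<subseteq>Y. Y' \<notin> I \<and> g \<le> f Y'" if Y: "Y \<subseteq> X" "Y \<notin> I" for Y g
  proof -
    have "\<exists>Y'\<subseteq>Y. (\<forall>n. Y' \<notin> T n) \<and> (\<forall>n. Y' \<inter> {..<g n} \<in> T n)"
    proof (rule slow_subset[OF T_her T_fd])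
      show "T n \<subseteq> T (Suc n)" for n unfolding T_def by (rule tower_Suc)
      show "{x} \<in> T 0" for x by (auto simp: T_def)
      show "E \<union> F \<in> T (Suc n)" if "E \<in> T n" "F \<in> T n" for n E F
        using that by (auto simp: T_def)
      show "Y \<notin> T n" for n using Y(2) T_I by blast
    qed
    then obtain Y' where Y': "Y' \<subseteq> Y" "\<And>n. Y' \<notin> T n" "\<And>n. Y' \<inter> {..<g n} \<in> T n" by blast
    have pos: "Y' \<notin> I" using T_cover[of Y'] Y'(1,2) Y(1) by blast
    have "g n \<le> f Y' n" for n
    proof (rule ccontr)
      assume "\<not> g n \<le> f Y' n"
      then have "Y' \<inter> {..<f Y' n} \<subseteq> Y' \<inter> {..<g n}" by auto
      then show False using least[OF pos] hereditaryD[OF T_her Y'(3)] by blast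
    qed
    then show ?thesis using Y'(1) pos by (auto intro: le_funI)
  qed
  ultimately have "tukey_map_below X f" unfolding tukey_map_below_def by blast
  then show ?thesis by blast
qed

end

section \<open>Ideals enumerated by a continuous map: splitting and Tukey maps\<close>

locale analytic_ideal = nat_ideal +
  fixes h :: "(nat \<Rightarrow> nat) \<Rightarrow> nat \<Rightarrow> bool"
  assumes h_cont: "continuous_on UNIV h"
    and h_range: "A \<in> I \<longleftrightarrow> (\<exists>x. A = {i. h x i})"
begin

lemma h_mem: "{i. h x i} \<in> I"
  using h_range by blast

lemma not_covered:
  assumes "Y \<notin> I" "finite F"
  shows "\<not> Y \<subseteq> F \<union> {i. h x i} \<union> {i. h y i}"
  using assms Un_mem finite_mem h_mem subset_mem by metis

text \<open>Cofinite subsets of \<open>X\<close> are almost equal to each other, so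
  pseudointersections come for free. The game gives countably many families of finite answers, met
  by every cofinite subset of \<open>Z\<close>; two disjoint sets can therefore collect an answer
  from each family.\<close>

lemma split_positive:
  assumes "X \<notin> I"
  shows "\<exists>A B. A \<subseteq> X \<and> B \<subseteq> X \<and> A \<inter> B = {} \<and> A \<notin> I \<and> B \<notin> I"
proof -
  define P where "P = {Y. Y \<subseteq> X \<and> finite (X - Y)}"
  have P: "Y \<notin> I" if "Y \<in> P" for Y
    using that assms subset_Un_mem[of Y "X - Y" X] finite_mem[of "X - Y"] unfolding P_def by blast
  interpret unfolded_game h P
  proof
    show "continuous_on UNIV h" by (rule h_cont)
    show "Y - F \<in> P" if "Y \<in> P" "finite F" for Y F
      using that finite_subset[of "X - (Y - F)" "(X - Y) \<union> F"] unfolding P_def by auto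
    show "\<exists>Z\<in>P. Z \<subseteq> V \<and> (\<forall>n::nat. \<exists>Y\<in>O' n. finite (Z - Y))"
      if V: "V \<in> P" and O': "\<And>n Y. Y \<in> P \<Longrightarrow> Y \<subseteq> V \<Longrightarrow> \<exists>Z\<in>P. Z \<subseteq> Y \<and> Z \<in> O' n" for V O'
    proof (intro bexI[OF _ V] conjI allI)
      fix n
      obtain Z where "Z \<in> P" "Z \<in> O' n" using O'[OF V] by blast
      moreover have "finite (V - Z)" if "Z \<in> P"
        using that V finite_subset[of "V - Z" "X - Z"] unfolding P_def by blast
      ultimately show "\<exists>Y\<in>O' n. finite (V - Y)" by blast
    qed simp
    show "\<not> Y \<subseteq> F \<union> {i. h x i} \<union> {i. h y i}" if "Y \<in> P" "finite F" for Y F x y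
      using not_covered P that by blast
  qed
  have "X \<in> P" by (simp add: P_def)
  then obtain Z \<SS> where Z: "Z \<in> P" and \<SS>: "answers Z [] {} \<SS>" using ex_answers by blast
  \<comment> \<open>Such a set defeats every witness \<open>x\<close>, so it is none of the sets
    \<open>{i. h x i}\<close>.\<close>
  have pos: "A \<notin> I" if "\<And>\<S>. \<S> \<in> \<SS> \<Longrightarrow> \<exists>s\<in>\<S>. s \<subseteq> A" for A
    using answers_defeat[OF \<SS> _ _ that] h_range by fastforce
  \<comment> \<open>Nonemptiness lets \<open>from_nat_into\<close> enumerate exactly
    \<open>\<SS>\<close>.\<close>
  have "\<SS> \<noteq> {}" using pos[of "{}"] finite_mem by blast
  define \<S> where "\<S> = from_nat_into \<SS>"
  have \<S>: "\<S> n \<in> \<SS>" "\<T> \<in> \<SS> \<Longrightarrow> \<exists>n. \<T> = \<S> n" for n \<T>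
    unfolding \<S>_def using \<open>\<SS> \<noteq> {}\<close> answers_countable[OF \<SS>]
    by (auto simp: from_nat_into) (metis from_nat_into_surj)
  define inv where "inv = (\<lambda>(A, B). finite A \<and> finite B \<and> A \<inter> B = {} \<and> A \<subseteq> Z \<and> B \<subseteq> Z)"
  define ext where "ext n = (\<lambda>(A, B) (A', B'). A \<subseteq> A' \<and> B \<subseteq> B' \<and>
    (\<exists>s\<in>\<S> n. s \<subseteq> A') \<and> (\<exists>s\<in>\<S> n. s \<subseteq> B'))" for n
  have fresh: "\<exists>s\<in>\<S> n. finite s \<and> s \<subseteq> Z - F" if "finite F" for n F
    using answers_meet[OF \<SS> \<S>(1)[of n] finite_removal[OF Z that]] answers_finite[OF \<SS> \<S>(1)[of n]]
    by blast
  have "\<exists>q. inv q \<and> ext n p q" if inv: "inv p" for n p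
  proof -
    obtain A B where p: "p = (A, B)" by (cases p)
    obtain s where s: "s \<in> \<S> n" "finite s" "s \<subseteq> Z - B" using fresh[of B n] inv by (auto simp: p inv_def)
    obtain t where t: "t \<in> \<S> n" "finite t" "t \<subseteq> Z - (A \<union> s)"
      using fresh[of "A \<union> s" n] inv s(2) by (auto simp: p inv_def)
    have "inv (A \<union> s, B \<union> t)" using inv s t by (auto simp: p inv_def)
    moreover have "ext n p (A \<union> s, B \<union> t)" using s(1) t(1) by (auto simp: p ext_def)
    ultimately show ?thesis by blast
  qed
  moreover have "inv ({}, {})" by (simp add: inv_def)
  ultimately obtain p where p: "\<And>n. inv (p n)" "\<And>n. ext n (p n) (p (Suc n))"
    using dependent_nat_choice[of "\<lambda>_. inv" ext] by metis
  define A B where "A = (\<Union>n. fst (p n))" and "B = (\<Union>n. snd (p n))"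
  have A_mono: "fst (p i) \<subseteq> fst (p j)" and B_mono: "snd (p i) \<subseteq> snd (p j)" if "i \<le> j" for i j
  proof -
    have "fst (p n) \<subseteq> fst (p (Suc n))" "snd (p n) \<subseteq> snd (p (Suc n))" for n
      using p(2)[of n] by (auto simp: ext_def split_beta)
    then show "fst (p i) \<subseteq> fst (p j)" "snd (p i) \<subseteq> snd (p j)"
      using lift_Suc_mono_le[of "\<lambda>n. fst (p n)"] lift_Suc_mono_le[of "\<lambda>n. snd (p n)"] that by auto
  qed
  have "A \<inter> B = {}"
  proof -
    have "False" if "a \<in> fst (p i)" "a \<in> snd (p j)" for a i j
      using that A_mono[of i "max i j"] B_mono[of j "max i j"] p(1)[of "max i j"]
      by (auto simp: inv_def split_beta)
    then show ?thesis by (auto simp: A_def B_def)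
  qed
  moreover have "\<exists>s\<in>\<S> n. s \<subseteq> A" "\<exists>s\<in>\<S> n. s \<subseteq> B" for n
    using p(2)[of n] unfolding A_def B_def ext_def split_beta by blast+
  then have "A \<notin> I" "B \<notin> I" using pos \<S>(2) by metis+
  moreover have "fst (p n) \<subseteq> Z" "snd (p n) \<subseteq> Z" for n
    using p(1)[of n] by (auto simp: inv_def split_beta)
  then have "A \<subseteq> X" "B \<subseteq> X"
    using Z unfolding A_def B_def P_def by blast+
  ultimately show ?thesis by blast
qed

text \<open>The case distinction asks whether the P-point property fails below some positive
  \<open>Z\<close>. If it never fails, pseudointersections strengthen \<open>distributive\<close> to
  \<open>almost_distributive\<close>, and the answers of the game present \<open>I\<close> below a
  condition as a countable union of closed pieces.\<close>

theorem ex_tukey_map: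
  assumes distributive: "\<And>(O' :: nat \<Rightarrow> nat set set) X. X \<notin> I \<Longrightarrow>
      (\<And>n Y. Y \<notin> I \<Longrightarrow> Y \<subseteq> X \<Longrightarrow> \<exists>Z\<in>O' n. Z \<notin> I \<and> Z \<subseteq> Y) \<Longrightarrow>
      \<exists>Z. Z \<notin> I \<and> Z \<subseteq> X \<and> (\<forall>n. \<exists>Y\<in>O' n. Z - Y \<in> I)"
    and X: "X \<notin> I"
  shows "\<exists>X' f. X' \<subseteq> X \<and> X' \<notin> I \<and> tukey_map_below X' f"
proof (cases "\<exists>C Z. (\<forall>n. C n \<in> I) \<and> Z \<subseteq> X \<and> Z \<notin> I \<and>
    (\<forall>Y. Y \<subseteq> Z \<longrightarrow> Y \<notin> I \<longrightarrow> (\<exists>n::nat. infinite (Y \<inter> C n)))")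
  case True
  then show ?thesis using tukey_map_if_not_p_point by metis
next
  case False
  have p_point: "\<exists>Y\<subseteq>Z. Y \<notin> I \<and> (\<forall>n. finite (Y \<inter> C n))"
    if "\<And>n. C n \<in> I" "Z \<subseteq> X" "Z \<notin> I" for C :: "nat \<Rightarrow> nat set" and Z
  proof (rule ccontr)
    assume "\<not> ?thesis"
    then have "\<forall>Y. Y \<subseteq> Z \<longrightarrow> Y \<notin> I \<longrightarrow> (\<exists>n. infinite (Y \<inter> C n))" by blast
    with that False show False by blast
  qed
  define P where "P = {Y. Y \<subseteq> X \<and> Y \<notin> I}"
  interpret unfolded_game h P
  proof
    show "continuous_on UNIV h" by (rule h_cont)
    show "Y - F \<in> P" if "Y \<in> P" "finite F" for Y F
      using that subset_Un_mem[of "Y - F" F Y] finite_mem unfolding P_def by blast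
    show "\<exists>Z\<in>P. Z \<subseteq> V \<and> (\<forall>n::nat. \<exists>Y\<in>O' n. finite (Z - Y))"
      if V: "V \<in> P" and O': "\<And>n Y. Y \<in> P \<Longrightarrow> Y \<subseteq> V \<Longrightarrow> \<exists>Z\<in>P. Z \<subseteq> Y \<and> Z \<in> O' n" for V O'
    proof -
      have "\<exists>Z\<in>O' n. Z \<notin> I \<and> Z \<subseteq> Y" if "Y \<notin> I" "Y \<subseteq> V" for n Y
        using O'[of Y n] that V unfolding P_def by blast
      then obtain Z where Z: "Z \<notin> I" "Z \<subseteq> V" "\<forall>n. \<exists>Y\<in>O' n. Z - Y \<in> I"
        using distributive[of V O'] V unfolding P_def by blast
      then obtain Y where Y: "\<And>n. Y n \<in> O' n" "\<And>n. Z - Y n \<in> I" by metis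
      \<comment> \<open>The errors \<open>Z - Y n\<close> are in \<open>I\<close>; the P-point
        property thins \<open>Z\<close> to \<open>W\<close>, on which they are finite.\<close>
      have "\<exists>W\<subseteq>Z. W \<notin> I \<and> (\<forall>n. finite (W \<inter> (Z - Y n)))"
        using p_point[of "\<lambda>n. Z - Y n" Z] Y(2) Z(1,2) V unfolding P_def by blast
      then obtain W where W: "W \<subseteq> Z" "W \<notin> I" "\<And>n. finite (W \<inter> (Z - Y n))" by blast
      have "finite (W - Y n)" for n
        by (rule finite_subset[OF _ W(3)[of n]]) (use W(1) in blast)
      then have "\<forall>n. \<exists>Y\<in>O' n. finite (W - Y)" using Y(1) by meson
      moreover have "W \<subseteq> V" using W(1) Z(2) by (rule order_trans)
      moreover from this have "W \<in> P" using W(2) V by (auto simp: P_def)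
      ultimately show ?thesis by blast
    qed
    show "\<not> Y \<subseteq> F \<union> {i. h x i} \<union> {i. h y i}" if "Y \<in> P" "finite F" for Y F x y
      using not_covered that unfolding P_def by blast
  qed
  have "X \<in> P" using X by (simp add: P_def)
  then obtain Z \<SS> where Z: "Z \<in> P" and \<SS>: "answers Z [] {} \<SS>" using ex_answers by blast
  have pos: "A \<notin> I" if "\<And>\<S>. \<S> \<in> \<SS> \<Longrightarrow> \<exists>s\<in>\<S>. s \<subseteq> A" for A
    using answers_defeat[OF \<SS> _ _ that] h_range by fastforce
  have "\<SS> \<noteq> {}" using pos[of "{}"] finite_mem by blast
  define \<S> where "\<S> = from_nat_into \<SS>"
  have \<S>: "\<S> n \<in> \<SS>" "\<T> \<in> \<SS> \<Longrightarrow> \<exists>n. \<T> = \<S> n" for n \<T>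
    unfolding \<S>_def using \<open>\<SS> \<noteq> {}\<close> answers_countable[OF \<SS>]
    by (auto simp: from_nat_into) (metis from_nat_into_surj)
  \<comment> \<open>Sets evading the family \<open>\<S> n\<close>: closed because answers are
    finite, inside \<open>I\<close> because positive sets meet every family, and exhausting
    \<open>I\<close> below \<open>Z\<close> by \<open>pos\<close>.\<close>
  define K where "K n = {Y. Y \<subseteq> Z \<and> (\<forall>s\<in>\<S> n. \<not> s \<subseteq> Y)}" for n
  have "\<exists>f. tukey_map_below Z f"
  proof (rule tukey_map_if_fsigma[of K])
    fix n
    show "hereditary (K n)" unfolding hereditary_def K_def by blast
    show "finitely_determined (K n)"
      unfolding finitely_determined_def
    proof (intro allI impI)
      fix Y assume Y: "\<forall>k. Y \<inter> {..<k} \<in> K n"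
      have "Y \<subseteq> Z"
      proof
        fix y assume "y \<in> Y"
        then show "y \<in> Z" using Y[rule_format, of "Suc y"] by (auto simp: K_def)
      qed
      moreover have "\<not> s \<subseteq> Y" if s: "s \<in> \<S> n" for s
      proof -
        obtain k where "s \<subseteq> {..<k}"
          using answers_finite[OF \<SS> \<S>(1) s] finite_nat_iff_bounded by metis
        then show ?thesis using Y[rule_format, of k] s by (auto simp: K_def)
      qed
      ultimately show "Y \<in> K n" by (simp add: K_def)
    qed
    show "K n \<subseteq> I"
    proof
      fix Y assume "Y \<in> K n"
      then show "Y \<in> I" using answers_meet[OF \<SS> \<S>(1)[of n], of Y] Z by (auto simp: K_def P_def)
    qed
  next
    fix Y assume Y: "Y \<subseteq> Z" "Y \<in> I"
    then obtain \<T> where \<T>: "\<T> \<in> \<SS>" "\<And>s. s \<in> \<T> \<Longrightarrow> \<not> s \<subseteq> Y" using pos[of Y] by blast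
    obtain n where "\<T> = \<S> n" using \<S>(2)[OF \<T>(1)] by blast
    then show "\<exists>n. Y \<in> K n" using Y(1) \<T>(2) by (auto simp: K_def)
  qed
  then show ?thesis using Z unfolding P_def by blast
qed

end

section \<open>The quotient forcing\<close>

context nat_ideal
begin

abbreviation R :: "nat set set rel" where "R \<equiv> quotient_forcing I"

abbreviation cl :: "nat set \<Rightarrow> nat set set" where "cl \<equiv> ideal_class I"

lemma cl_eq_iff: "cl A = cl B \<longleftrightarrow> A - B \<in> I \<and> B - A \<in> I"
proof
  assume "cl A = cl B"
  moreover have "B \<in> cl B" by (simp add: ideal_class_def ideal_equiv_def finite_mem)
  ultimately have "B \<in> cl A" by simp
  then have "(A - B) \<union> (B - A) \<in> I" by (simp add: ideal_class_def ideal_equiv_def)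
  then show "A - B \<in> I \<and> B - A \<in> I" by (auto intro: subset_mem)
next
  assume AB: "A - B \<in> I \<and> B - A \<in> I"
  have "(A - C) \<union> (C - A) \<in> I \<longleftrightarrow> (B - C) \<union> (C - B) \<in> I" for C
  proof
    assume "(A - C) \<union> (C - A) \<in> I"
    then have "((A - C) \<union> (C - A)) \<union> ((A - B) \<union> (B - A)) \<in> I" using AB Un_mem by blast
    then show "(B - C) \<union> (C - B) \<in> I" by (rule subset_mem) blast
  next
    assume "(B - C) \<union> (C - B) \<in> I"
    then have "((B - C) \<union> (C - B)) \<union> ((A - B) \<union> (B - A)) \<in> I" using AB Un_mem by blast
    then show "(A - C) \<union> (C - A) \<in> I" by (rule subset_mem) blast
  qed
  then show "cl A = cl B" by (simp add: ideal_class_def ideal_equiv_def)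
qed

text \<open>Changing representatives alters the sets involved only by members of
  \<open>I\<close>.\<close>

lemma R_iff: "(cl A, cl B) \<in> R \<longleftrightarrow> A \<notin> I \<and> B \<notin> I \<and> A - B \<in> I"
proof
  assume "(cl A, cl B) \<in> R"
  then obtain A' B' where *: "cl A = cl A'" "cl B = cl B'" "A' \<notin> I" "B' \<notin> I" "A' - B' \<in> I"
    unfolding quotient_forcing_def by blast
  have d: "A - A' \<in> I" "A' - A \<in> I" "B' - B \<in> I" using *(1,2) unfolding cl_eq_iff by blast+
  have "A \<notin> I" using *(3) d(2) subset_Un_mem[of A "A' - A" A'] by blast
  moreover have "B \<notin> I" using *(4) d(3) subset_Un_mem[of B "B' - B" B'] by blast
  moreover have "(A - A') \<union> (A' - B') \<union> (B' - B) \<in> I" using *(5) d by (intro Un_mem)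
  then have "A - B \<in> I" by (rule subset_mem) blast
  ultimately show "A \<notin> I \<and> B \<notin> I \<and> A - B \<in> I" by blast
next
  assume "A \<notin> I \<and> B \<notin> I \<and> A - B \<in> I"
  then show "(cl A, cl B) \<in> R" unfolding quotient_forcing_def by blast
qed

lemma Field_iff: "p \<in> Field R \<longleftrightarrow> (\<exists>X. p = cl X \<and> X \<notin> I)"
proof
  assume "p \<in> Field R"
  then show "\<exists>X. p = cl X \<and> X \<notin> I" unfolding Field_def quotient_forcing_def by blast
next
  assume "\<exists>X. p = cl X \<and> X \<notin> I"
  then obtain X where "p = cl X" "X \<notin> I" by blast
  then have "(p, p) \<in> R" by (simp add: R_iff finite_mem)
  then show "p \<in> Field R" by (rule FieldI1)
qed

lemma R_trans: "(r, q) \<in> R \<Longrightarrow> (q, p) \<in> R \<Longrightarrow> (r, p) \<in> R"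
proof -
  assume r: "(r, q) \<in> R" "(q, p) \<in> R"
  then obtain A B C where *: "r = cl A" "q = cl B" "p = cl C"
    using Field_iff FieldI1 FieldI2 by metis
  have "A - C \<in> I" using r subset_Un_mem[of "A - B" "B - C" "A - C"] unfolding * R_iff by blast
  then show "(r, p) \<in> R" using r unfolding * R_iff by blast
qed

end

sublocale nat_ideal \<subseteq> forcing "quotient_forcing I"
proof
  show "(p, p) \<in> R" if "p \<in> Field R" for p
    using that by (auto simp: Field_iff R_iff finite_mem)
qed (rule R_trans)

section \<open>Separativity and forced membership in the generic ultrafilter\<close>

context nat_ideal
begin

abbreviation stronger_class (infix "\<preceq>" 50) where
  "q \<preceq> p \<equiv> (q, p) \<in> R"

lemma below_cl: "q \<preceq> cl X \<Longrightarrow> \<exists>W. q = cl W \<and> W \<notin> I \<and> W - X \<in> I"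
  by (metis FieldI1 Field_iff R_iff)

lemma cl_mono: "A \<subseteq> B \<Longrightarrow> A \<notin> I \<Longrightarrow> cl A \<preceq> cl B"
  using R_iff subset_mem finite_mem[OF finite.emptyI] Diff_eq_empty_iff[of A B] by metis

text \<open>If \<open>X - A\<close> were positive, its class would be a condition below
  \<open>p\<close> incompatible with \<open>cl A\<close>.\<close>

lemma separative:
  assumes "p \<in> Field R" "\<And>q. q \<preceq> p \<Longrightarrow> \<exists>r. r \<preceq> q \<and> r \<preceq> cl A"
  shows "p \<preceq> cl A"
proof -
  obtain X where X: "p = cl X" "X \<notin> I" using assms(1) Field_iff by blast
  have "X - A \<in> I"
  proof (rule ccontr)
    assume "X - A \<notin> I"
    then have "cl (X - A) \<preceq> p" unfolding X(1) by (intro cl_mono) auto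
    then obtain r where r: "r \<preceq> cl (X - A)" "r \<preceq> cl A" using assms(2) by blast
    then obtain W where W: "r = cl W" using below_cl by blast
    have "W \<in> I" using r subset_Un_mem[of "W - (X - A)" "W - A" W] unfolding W R_iff by blast
    then show False using r unfolding W R_iff by blast
  qed
  moreover have "A \<notin> I" using subset_Un_mem[of A "X - A" X] X(2) calculation by blast
  ultimately show ?thesis using X by (simp add: R_iff)
qed

lemma f_in_generic_name:
  assumes "p \<in> Field R"
  shows "f_in R (cl A) (generic_name R) p \<longleftrightarrow> p \<preceq> cl A"
proof
  assume *: "f_in R (cl A) (generic_name R) p"
  show "p \<preceq> cl A"
  proof (rule separative[OF assms])
    fix q assume "q \<preceq> p"
    then show "\<exists>r. r \<preceq> q \<and> r \<preceq> cl A" using * unfolding f_in_iff generic_name_def by blast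
  qed
next
  assume p: "p \<preceq> cl A"
  show "f_in R (cl A) (generic_name R) p"
    unfolding f_in_iff
  proof (intro allI impI)
    fix q assume q: "q \<preceq> p"
    have "(cl A, cl A) \<in> generic_name R" using FieldI2[OF p] by (simp add: generic_name_def)
    moreover have "q \<preceq> q" using FieldI1[OF q] by (rule refl)
    moreover have "q \<preceq> cl A" using q p by (rule trans)
    ultimately show "\<exists>r s. r \<preceq> q \<and> (cl A, s) \<in> generic_name R \<and> r \<preceq> s" by blast
  qed
qed

abbreviation U :: "((nat, nat set set) name, nat set set) name" where
  "U \<equiv> generic_ultrafilter I"

lemma U_iff: "(\<pi>, s) \<in> U \<longleftrightarrow> (\<exists>A. \<pi> = check R A \<and> s \<preceq> cl A)"
  unfolding generic_ultrafilter_def Let_def using f_in_generic_name FieldI1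
  by (smt (verit) mem_Collect_eq prod.inject)

text \<open>The name \<open>U\<close> contains only ground-model sets, and the one equal to a
  decided \<open>x\<close> must be \<open>A\<close>. Separativity then removes the density
  quantifier.\<close>

lemma mem_U_decided:
  assumes "decides x A p" "p \<in> Field R"
  shows "f_mem R (f_eq R) x U p \<longleftrightarrow> p \<preceq> cl A"
proof
  assume *: "f_mem R (f_eq R) x U p"
  show "p \<preceq> cl A"
  proof (rule separative[OF assms(2)])
    fix q assume q: "q \<preceq> p"
    then obtain r A' s where r: "r \<preceq> q" "s \<preceq> cl A'" "r \<preceq> s" "f_eq R x (check R A') r"
      using * unfolding f_mem_iff U_iff by blast
    have "r \<preceq> p" using r(1) q by (rule trans)
    then have "decides x A r" using assms(1) decides_mono by blast
    then have "A = A'" using f_eq_decided[OF _ decides_check FieldI1[OF r(1)]] r(4) by blast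
    moreover have "r \<preceq> cl A'" using r(3,2) by (rule trans)
    ultimately show "\<exists>r. r \<preceq> q \<and> r \<preceq> cl A" using r(1) by blast
  qed
next
  assume p: "p \<preceq> cl A"
  show "f_mem R (f_eq R) x U p"
    unfolding f_mem_iff
  proof (intro allI impI)
    fix q assume q: "q \<preceq> p"
    have "q \<preceq> cl A" using q p by (rule trans)
    then have "(check R A, q) \<in> U" using U_iff by blast
    moreover have "q \<preceq> q" using FieldI1[OF q] by (rule refl)
    moreover have "f_eq R x (check R A) q"
      using f_eq_decided[OF decides_mono[OF assms(1) q] decides_check FieldI1[OF q]] by blast
    ultimately show "\<exists>r \<pi> s. r \<preceq> q \<and> (\<pi>, s) \<in> U \<and> r \<preceq> s \<and> f_eq R x \<pi> r" by blast
  qed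
qed

end

section \<open>The generic ultrafilter in the absence of new reals\<close>

locale no_reals_ideal = nat_ideal +
  assumes no_reals': "adds_no_reals (quotient_forcing I)"

sublocale no_reals_ideal \<subseteq> forcing_no_reals "quotient_forcing I"
  by unfold_locales (rule no_reals')

context no_reals_ideal
begin

lemma ex_decides_pair:
  fixes x :: "('b::countable, nat set set) name" and y :: "('c::countable, nat set set) name"
  assumes "p \<in> Field R"
  shows "\<exists>q A B. q \<preceq> p \<and> decides x A q \<and> decides y B q"
proof -
  obtain q A where q: "q \<preceq> p" "decides x A q" using ex_decides[OF assms] by blast
  obtain r B where r: "r \<preceq> q" "decides y B r" using ex_decides[OF FieldI1[OF q(1)]] by blast
  have "r \<preceq> p" using r(1) q(1) by (rule trans)
  then show ?thesis using r decides_mono[OF q(2) r(1)] by blast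
qed

text \<open>In the clauses that quantify over names, the sets are decided first; membership in
  \<open>U\<close> is then a statement about the order of the quotient.\<close>

lemma forces_ultrafilter:
  assumes p: "p \<in> Field R"
  shows "f_ultrafilter R U p"
proof -
  let ?mem = "\<lambda>x. f_mem R (f_eq R) x U"
  have 1: "?mem (check R UNIV) p"
    using p cl_mono[OF subset_UNIV] mem_U_decided[OF decides_check p] Field_iff by metis
  have 2: "f_not R (?mem (check R {})) p"
    unfolding f_not_def
  proof (intro allI impI)
    fix q assume "q \<preceq> p"
    then have "q \<in> Field R" by (rule FieldI1)
    moreover have "\<not> q \<preceq> cl {}"
      using \<open>q \<in> Field R\<close> finite_mem[of "{}"] by (auto simp: Field_iff R_iff)
    ultimately show "\<not> ?mem (check R {}) q" using mem_U_decided[OF decides_check] by blast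
  qed
  have 3: "f_imp R (?mem x \<^bold>\<and> f_subset R x y) (?mem y) p" for x y
    unfolding f_imp_iff f_and_def
  proof (intro allI impI)
    fix q assume q: "q \<preceq> p" "?mem x q \<and> f_subset R x y q"
    obtain r A B where r: "r \<preceq> q" "decides x A r" "decides y B r"
      using ex_decides_pair[OF FieldI1[OF q(1)]] by blast
    have rF: "r \<in> Field R" using r(1) by (rule FieldI1)
    have "?mem x r" "f_subset R x y r"
      using persistentD[OF persistent_mem conjunct1[OF q(2)] r(1)]
        persistentD[OF persistent_subset conjunct2[OF q(2)] r(1)] by this
    then have A: "r \<preceq> cl A" "A \<subseteq> B"
      using mem_U_decided[OF r(2) rF] f_subset_decided[OF r(2,3) rF] by blast+
    then have "A \<notin> I" using rF by (auto simp: Field_iff R_iff)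
    then have "r \<preceq> cl B" using trans[OF A(1) cl_mono[OF A(2)]] by blast
    then show "\<exists>r. r \<preceq> q \<and> ?mem y r" using mem_U_decided[OF r(3) rF] r(1) by blast
  qed
  have 4: "f_imp R (?mem x \<^bold>\<and> ?mem y \<^bold>\<and>
      (\<^bold>\<forall>n. f_iff R (f_in R n z) (f_in R n x \<^bold>\<and> f_in R n y))) (?mem z) p" for x y z
    unfolding f_imp_iff[where p=p] f_and_def[of "?mem x"] f_and_def[of "?mem y"]
  proof (intro allI impI)
    fix q
    assume q: "q \<preceq> p" "?mem x q \<and> ?mem y q \<and>
      (\<^bold>\<forall>n. f_iff R (f_in R n z) (f_in R n x \<^bold>\<and> f_in R n y)) q"
    obtain q' A B where q': "q' \<preceq> q" "decides x A q'" "decides y B q'"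
      using ex_decides_pair[OF FieldI1[OF q(1)]] by blast
    obtain r C where r: "r \<preceq> q'" "decides z C r" using ex_decides[OF FieldI1[OF q'(1)]] by blast
    note xr = decides_mono[OF q'(2) r(1)] and yr = decides_mono[OF q'(3) r(1)]
    have rF: "r \<in> Field R" using r(1) by (rule FieldI1)
    have rq: "r \<preceq> q" using r(1) q'(1) by (rule trans)
    have "?mem x r" "?mem y r" using persistentD[OF persistent_mem conjunct1[OF q(2)] rq]
        persistentD[OF persistent_mem conjunct1[OF conjunct2[OF q(2)]] rq] by this
    then have AB: "r \<preceq> cl A" "r \<preceq> cl B" using mem_U_decided[OF xr rF] mem_U_decided[OF yr rF] by blast+
    have iff: "f_iff R (f_in R n z) (f_in R n x \<^bold>\<and> f_in R n y) r" for n
      by (rule persistentD[OF persistent_iff _ rq]) (use q(2) in \<open>simp add: f_all_def\<close>)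
    have "C = A \<inter> B"
    proof (rule set_eqI)
      fix n
      have dec: "f_in R n z s \<longleftrightarrow> n \<in> C" "(f_in R n x \<^bold>\<and> f_in R n y) s \<longleftrightarrow> n \<in> A \<inter> B"
        if "s \<preceq> r" for s
        using f_in_decided_below[OF r(2) that] f_in_decided_below[OF xr that]
          f_in_decided_below[OF yr that] by (simp_all add: f_and_def)
      show "n \<in> C \<longleftrightarrow> n \<in> A \<inter> B"
        using iff[of n] dec refl[OF rF] unfolding f_iff_iff f_imp_iff by blast
    qed
    moreover have "r \<preceq> cl (A \<inter> B)"
    proof -
      obtain W where W: "r = cl W" "W \<notin> I" "W - A \<in> I" using below_cl[OF AB(1)] by blast
      have "W - B \<in> I" using AB(2) by (simp add: W(1) R_iff)
      then have D: "W - (A \<inter> B) \<in> I" by (rule subset_Un_mem[OF W(3)]) blast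
      then have "A \<inter> B \<notin> I" using subset_Un_mem[of "A \<inter> B" "W - (A \<inter> B)" W] W(2) by blast
      then show ?thesis using D W by (simp add: R_iff)
    qed
    ultimately show "\<exists>r. r \<preceq> q \<and> ?mem z r" using mem_U_decided[OF r(2) rF] rq by blast
  qed
  have 5: "f_imp R (\<^bold>\<forall>n. f_iff R (f_in R n y) (f_not R (f_in R n x))) (f_or R (?mem x) (?mem y)) p"
    for x y
    unfolding f_imp_iff[where p=p]
  proof (intro allI impI)
    fix q
    assume q: "q \<preceq> p" "(\<^bold>\<forall>n. f_iff R (f_in R n y) (f_not R (f_in R n x))) q"
    obtain r A B where r: "r \<preceq> q" "decides x A r" "decides y B r"
      using ex_decides_pair[OF FieldI1[OF q(1)]] by blast
    have rF: "r \<in> Field R" using r(1) by (rule FieldI1)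
    have iff: "f_iff R (f_in R n y) (f_not R (f_in R n x)) r" for n
      by (rule persistentD[OF persistent_iff _ r(1)]) (use q(2) in \<open>simp add: f_all_def\<close>)
    have B: "B = - A"
    proof (rule set_eqI)
      fix n
      have "f_not R (f_in R n x) s \<longleftrightarrow> n \<notin> A" if "s \<preceq> r" for s
        unfolding f_not_def
        using f_in_decided_below[OF decides_mono[OF r(2) that]] refl[OF FieldI1[OF that]] by blast
      then show "n \<in> B \<longleftrightarrow> n \<in> - A"
        using iff[of n] refl[OF rF] f_in_decided_below[OF r(3)]
        unfolding f_iff_iff f_imp_iff by blast
    qed
    have "f_or R (?mem x) (?mem y) r"
      unfolding f_or_iff
    proof (intro allI impI)
      fix s assume s: "s \<preceq> r"
      obtain W where W: "s = cl W" "W \<notin> I" using FieldI1[OF s] Field_iff by blast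
      \<comment> \<open>One of the two parts of \<open>W\<close> is positive, and its class forces
        the corresponding set into \<open>U\<close>.\<close>
      then have "W \<inter> A \<notin> I \<or> W \<inter> B \<notin> I" using subset_Un_mem[of "W \<inter> A" "W \<inter> B" W] B by blast
      then obtain C where C: "C = A \<or> C = B" "W \<inter> C \<notin> I" by blast
      have t: "cl (W \<inter> C) \<preceq> s" "cl (W \<inter> C) \<preceq> cl C"
        unfolding W(1) using C(2) by (auto intro: cl_mono)
      have tr: "cl (W \<inter> C) \<preceq> r" using t(1) s by (rule trans)
      then have "?mem x (cl (W \<inter> C)) \<or> ?mem y (cl (W \<inter> C))"
        using C(1) t(2) mem_U_decided[OF decides_mono[OF r(2) tr] FieldI1[OF tr]]
          mem_U_decided[OF decides_mono[OF r(3) tr] FieldI1[OF tr]] by blast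
      then show "\<exists>t. t \<preceq> s \<and> (?mem x t \<or> ?mem y t)" using t(1) by blast
    qed
    then show "\<exists>r. r \<preceq> q \<and> f_or R (?mem x) (?mem y) r" using r(1) by blast
  qed
  show ?thesis
    unfolding f_ultrafilter_def Let_def by (intro f_andI f_allI 1 2 3 4 5)
qed

text \<open>If a condition \<open>cl X\<close> forced \<open>U\<close> to be \<open>\<A>\<close>,
  split \<open>X\<close> into \<open>A\<close> and \<open>B\<close>. Below \<open>cl A\<close> one
  finds \<open>A \<in> \<A>\<close>, which depends on no condition; so \<open>A\<close> would enter
  \<open>U\<close> below \<open>cl B\<close> too, although \<open>A\<close> and \<open>B\<close> are
  disjoint.\<close>

lemma forces_new_family:
  assumes split: "\<And>X. X \<notin> I \<Longrightarrow> \<exists>A B. A \<subseteq> X \<and> B \<subseteq> X \<and> A \<inter> B = {} \<and> A \<notin> I \<and> B \<notin> I"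
  shows "f_new_family R U p"
  unfolding f_new_family_def f_all_def f_not_def
proof (intro allI impI notI)
  fix \<A> q
  assume q: "q \<preceq> p" and "f_set_eq R (f_eq R) U (check_family R \<A>) q"
  then have eq: "f_imp R (f_mem R (f_eq R) x U) (f_mem R (f_eq R) x (check_family R \<A>)) q"
    "f_imp R (f_mem R (f_eq R) x (check_family R \<A>)) (f_mem R (f_eq R) x U) q" for x
    unfolding f_set_eq_def f_all_def f_iff_iff by blast+
  obtain X where X: "q = cl X" "X \<notin> I" using FieldI1[OF q] Field_iff by blast
  obtain A B where AB: "A \<subseteq> X" "B \<subseteq> X" "A \<inter> B = {}" "A \<notin> I" "B \<notin> I" using split[OF X(2)] by blast
  have A: "cl A \<preceq> q" "cl A \<preceq> cl A" and B: "cl B \<preceq> q"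
    unfolding X(1) using AB by (auto intro: cl_mono)
  have "f_mem R (f_eq R) (check R A) U (cl A)"
    using mem_U_decided[OF decides_check FieldI1[OF A(2)]] A(2) by blast
  then obtain r where r: "r \<preceq> cl A" "f_mem R (f_eq R) (check R A) (check_family R \<A>) r"
    using eq(1) A(1) unfolding f_imp_iff by blast
  then obtain s A' where s: "s \<preceq> r" "A' \<in> \<A>" "f_eq R (check R A) (check R A') s"
    using refl[OF FieldI1[OF r(1)]] unfolding f_mem_iff check_family_def by blast
  have "A \<in> \<A>"
    using f_eq_decided[OF decides_check[of A] decides_check[of A'] FieldI1[OF s(1)]] s(2,3) by simp
  \<comment> \<open>The fact found below \<open>cl A\<close> is transferred to the incompatible
    condition \<open>cl B\<close>.\<close>
  have "f_mem R (f_eq R) (check R A) (check_family R \<A>) (cl B)"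
    unfolding f_mem_iff
  proof (intro allI impI)
    fix q assume q: "q \<preceq> cl B"
    have "q \<preceq> q" using FieldI1[OF q] by (rule refl)
    moreover have "(check R A, q) \<in> check_family R \<A>"
      using \<open>A \<in> \<A>\<close> FieldI1[OF q] by (simp add: check_family_def)
    moreover have "f_eq R (check R A) (check R A) q"
      using f_eq_decided[OF decides_check[of A] decides_check[of A] FieldI1[OF q]] by simp
    ultimately show "\<exists>r \<pi> s. r \<preceq> q \<and> (\<pi>, s) \<in> check_family R \<A> \<and> r \<preceq> s \<and> f_eq R (check R A) \<pi> r"
      by blast
  qed
  then obtain t where t: "t \<preceq> cl B" "f_mem R (f_eq R) (check R A) U t"
    using eq(2) B unfolding f_imp_iff by blast
  then have "t \<preceq> cl A" using mem_U_decided[OF decides_check FieldI1[OF t(1)]] by blast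
  moreover obtain W where W: "t = cl W" "W \<notin> I" "W - B \<in> I" using below_cl[OF t(1)] by blast
  ultimately have "W - A \<in> I" by (simp add: R_iff)
  then have "W \<in> I" by (rule subset_Un_mem[OF W(3)]) (use AB(3) in blast)
  then show False using W(2) by blast
qed

text \<open>Conditions are represented by reals. So a sequence of members of the generic filter, chosen
  from maximal antichains, is a real, and a condition deciding it is a common lower bound.\<close>

lemma distributive:
  fixes O' :: "nat \<Rightarrow> nat set set"
  assumes X: "X \<notin> I"
    and dense: "\<And>n Y. Y \<notin> I \<Longrightarrow> Y \<subseteq> X \<Longrightarrow> \<exists>Z\<in>O' n. Z \<notin> I \<and> Z \<subseteq> Y"
  shows "\<exists>Z. Z \<notin> I \<and> Z \<subseteq> X \<and> (\<forall>n. \<exists>Y\<in>O' n. Z - Y \<in> I)"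
proof -
  define antichain where "antichain \<A> \<longleftrightarrow> (\<forall>Y\<in>\<A>. \<forall>Y'\<in>\<A>. Y \<noteq> Y' \<longrightarrow> Y \<inter> Y' \<in> I)" for \<A>
  \<comment> \<open>Zorn's lemma gives a maximal antichain of positive members of
    \<open>O' n\<close>; by density every positive subset of \<open>X\<close> is compatible with one
    of them.\<close>
  have "\<exists>\<A>. \<A> \<subseteq> O' n \<and> antichain \<A> \<and> (\<forall>Y\<in>\<A>. Y \<notin> I) \<and>
      (\<forall>W. W \<notin> I \<longrightarrow> W \<subseteq> X \<longrightarrow> (\<exists>Y\<in>\<A>. W \<inter> Y \<notin> I))" for n
  proof -
    define \<AA> where "\<AA> = {\<A>. \<A> \<subseteq> {Y\<in>O' n. Y \<notin> I} \<and> antichain \<A>}"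
    have "\<exists>M\<in>\<AA>. \<forall>\<A>\<in>\<AA>. M \<subseteq> \<A> \<longrightarrow> \<A> = M"
    proof (rule subset_Zorn_nonempty)
      have "{} \<in> \<AA>" by (simp add: \<AA>_def antichain_def)
      then show "\<AA> \<noteq> {}" by blast
      show "\<Union>\<C> \<in> \<AA>" if "\<C> \<noteq> {}" and chain: "subset.chain \<AA> \<C>" for \<C>
      proof -
        have "Y \<inter> Y' \<in> I" if Y: "Y \<in> \<Union>\<C>" "Y' \<in> \<Union>\<C>" "Y \<noteq> Y'" for Y Y'
        proof -
          obtain A A' where A: "A \<in> \<C>" "A' \<in> \<C>" "Y \<in> A" "Y' \<in> A'" using Y by blast
          then have "A \<subseteq> A' \<or> A' \<subseteq> A" using chain by (meson subset.chain_def subset_chain_def)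
          then obtain B where "B \<in> \<C>" "Y \<in> B" "Y' \<in> B" using A by blast
          moreover from this have "antichain B" using chain by (auto simp: subset_chain_def \<AA>_def)
          ultimately show ?thesis using Y(3) by (simp add: antichain_def)
        qed
        then show ?thesis using chain by (auto simp: \<AA>_def antichain_def subset_chain_def)
      qed
    qed
    then obtain M where M: "M \<in> \<AA>" "\<And>\<A>. \<A> \<in> \<AA> \<Longrightarrow> M \<subseteq> \<A> \<Longrightarrow> \<A> = M" by blast
    have "\<exists>Y\<in>M. W \<inter> Y \<notin> I" if W: "W \<notin> I" "W \<subseteq> X" for W
    proof (rule ccontr)
      assume *: "\<not> (\<exists>Y\<in>M. W \<inter> Y \<notin> I)"
      obtain Z where Z: "Z \<in> O' n" "Z \<notin> I" "Z \<subseteq> W" using dense W by blast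
      have ZM: "Z \<inter> Y \<in> I" if "Y \<in> M" for Y
        using * that Z(3) subset_mem[of "W \<inter> Y" "Z \<inter> Y"] by blast
      then have "antichain (insert Z M)"
        using M(1) unfolding antichain_def \<AA>_def by (auto simp: Int_commute)
      then have "insert Z M \<in> \<AA>" using M(1) Z by (auto simp: \<AA>_def)
      then have "Z \<in> M" using M(2) by blast
      then show False using ZM Z(2) by fastforce
    qed
    then show ?thesis using M(1) unfolding \<AA>_def by (intro exI[of _ M]) blast
  qed
  then obtain \<A> where \<A>: "\<And>n. \<A> n \<subseteq> O' n" "\<And>n. antichain (\<A> n)" "\<And>n Y. Y \<in> \<A> n \<Longrightarrow> Y \<notin> I"
    and max: "\<And>n W. W \<notin> I \<Longrightarrow> W \<subseteq> X \<Longrightarrow> \<exists>Y\<in>\<A> n. W \<inter> Y \<notin> I"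
    by metis
  \<comment> \<open>Below \<open>cl X\<close>, the slice of \<open>\<tau>\<close> at
    \<open>n\<close> names the member of \<open>\<A> n\<close> chosen by the generic filter.\<close>
  define \<tau> :: "(nat \<times> nat, nat set set) name" where
    "\<tau> = {((n, i), cl Y) | n i Y. Y \<in> \<A> n \<and> i \<in> Y}"
  have "cl X \<in> Field R" using X Field_iff by blast
  then obtain q T where q: "q \<preceq> cl X" "decides \<tau> T q" using ex_decides by blast
  then obtain Z' where Z': "q = cl Z'" "Z' \<notin> I" "Z' - X \<in> I" using below_cl by blast
  define Z where "Z = Z' \<inter> X"
  have Z: "Z \<subseteq> X" "Z \<notin> I"
    unfolding Z_def using subset_Un_mem[of "Z' \<inter> X" "Z' - X" Z'] Z'(2,3) by blast+
  have "cl Z \<preceq> q" unfolding Z'(1) using Z(2) by (intro cl_mono) (auto simp: Z_def)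
  then have T: "decides \<tau> T (cl Z)" using q(2) decides_mono by blast
  \<comment> \<open>\<open>cl (Z \<inter> Y)\<close> forces the slice at \<open>n\<close> to be
    \<open>Y\<close>, while \<open>T\<close> is already decided at \<open>cl Z\<close>. So at most
    one member of \<open>\<A> n\<close> is compatible with \<open>Z\<close>.\<close>
  have slice: "Y = {i. (n, i) \<in> T}" if Y: "Y \<in> \<A> n" "Z \<inter> Y \<notin> I" for n Y
  proof (rule set_eqI)
    fix i
    define r where "r = cl (Z \<inter> Y)"
    have r: "r \<preceq> cl Z" "r \<preceq> cl Y"
      unfolding r_def using Y(2) by (auto intro: cl_mono)
    have "f_in R (n, i) \<tau> r" if "i \<in> Y"
      unfolding f_in_iff
    proof (intro allI impI)
      fix s assume s: "s \<preceq> r"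
      have "s \<preceq> s" using FieldI1[OF s] by (rule refl)
      moreover have "s \<preceq> cl Y" using s r(2) by (rule trans)
      moreover have "((n, i), cl Y) \<in> \<tau>" using that Y(1) by (auto simp: \<tau>_def)
      ultimately show "\<exists>t u. t \<preceq> s \<and> ((n, i), u) \<in> \<tau> \<and> t \<preceq> u" by blast
    qed
    moreover have "i \<in> Y" if in_\<tau>: "f_in R (n, i) \<tau> r"
    proof (rule ccontr)
      assume "i \<notin> Y"
      obtain t Y' where t: "t \<preceq> r" "Y' \<in> \<A> n" "i \<in> Y'" "t \<preceq> cl Y'"
        using in_\<tau> refl[OF FieldI1[OF r(1)]] unfolding f_in_iff \<tau>_def by blast
      then have "Y \<inter> Y' \<in> I" using \<A>(2)[of n] Y(1) \<open>i \<notin> Y\<close> unfolding antichain_def by blast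
      moreover obtain W where W: "t = cl W" "W \<notin> I" "W - Y' \<in> I" using below_cl[OF t(4)] by blast
      moreover have "W - Y \<in> I" using trans[OF t(1) r(2)] by (simp add: W R_iff)
      ultimately have "(W - Y) \<union> (W - Y') \<union> (Y \<inter> Y') \<in> I" using Un_mem by blast
      then have "W \<in> I" by (rule subset_mem) blast
      then show False using W(2) by blast
    qed
    ultimately show "i \<in> Y \<longleftrightarrow> i \<in> {i. (n, i) \<in> T}"
      using f_in_decided_below[OF T r(1)] by blast
  qed
  have "\<exists>Y\<in>O' n. Z - Y \<in> I" for n
  proof -
    obtain Y where Y: "Y \<in> \<A> n" "Z \<inter> Y \<notin> I" using max Z by blast
    \<comment> \<open>Otherwise maximality yields a member compatible with \<open>Z - Y\<close>,
      which by \<open>slice\<close> is \<open>Y\<close> again.\<close>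
    have "Z - Y \<in> I"
    proof (rule ccontr)
      assume "Z - Y \<notin> I"
      then obtain Y' where Y': "Y' \<in> \<A> n" "(Z - Y) \<inter> Y' \<notin> I" using max[of "Z - Y" n] Z(1) by blast
      then have "Z \<inter> Y' \<notin> I" using subset_mem[of "Z \<inter> Y'" "(Z - Y) \<inter> Y'"] by blast
      then have "Y' = Y" using slice Y Y'(1) by blast
      then have "(Z - Y) \<inter> Y' = {}" by blast
      then show False using Y'(2) finite_mem[of "{}"] by simp
    qed
    then show ?thesis using Y(1) \<A>(1) by blast
  qed
  then show ?thesis using Z by blast
qed

text \<open>Below \<open>cl X'\<close> the map sends \<open>A\<close> in \<open>U\<close> to
  \<open>f (A \<inter> X')\<close>; the intersection moves \<open>A\<close> to where
  \<open>f\<close> is antitone. A given function lies below some \<open>f Y'\<close>, and members of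
  a cofinal set inside \<open>Y'\<close> have still larger values.\<close>

lemma forces_baire_tukey_le:
  assumes maps: "\<And>X. X \<notin> I \<Longrightarrow> \<exists>X' f. X' \<subseteq> X \<and> X' \<notin> I \<and> tukey_map_below X' f"
  shows "f_baire_tukey_le R U p"
  unfolding f_baire_tukey_le_def f_tukey_le_def f_ex_iff[where p=p]
proof (intro allI impI)
  fix q assume "q \<preceq> p"
  then obtain X where X: "q = cl X" "X \<notin> I" using FieldI1 Field_iff by metis
  obtain X' f where X': "X' \<subseteq> X" "X' \<notin> I" and f: "tukey_map_below X' f" using maps[OF X(2)] by blast
  define graph where "graph A = range (\<lambda>m. (m, f (A \<inter> X') m))" for A
  define F where "F = {((check R A, check R (graph A)), s) | A s. s \<preceq> cl A \<and> s \<preceq> cl X'}"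
  let ?U = "\<lambda>x. f_mem R (f_eq R) x U"
  let ?F = "\<lambda>a b. f_mem R (f_pair_eq (f_eq R) (f_eq R)) (a, b) F"
  \<comment> \<open>The clauses for \<open>F\<close> are checked on decided names, where
    \<open>F\<close> is the ground-model map restricted to members of \<open>U\<close>.\<close>
  have F_decided: "?F a b s \<longleftrightarrow> s \<preceq> cl A \<and> B = graph A"
    if s: "s \<preceq> cl X'" "decides a A s" "decides b B s" for a b s A B
  proof
    assume *: "?F a b s"
    have below: "\<exists>r. r \<preceq> t \<and> r \<preceq> cl A \<and> B = graph A" if t: "t \<preceq> s" for t
    proof -
      obtain r A' u where r: "r \<preceq> t" "u \<preceq> cl A'" "r \<preceq> u"
        "f_eq R a (check R A') r" "f_eq R b (check R (graph A')) r"
        using * t unfolding f_mem_iff F_def f_pair_eq_def f_and_def by fastforce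
      have rs: "r \<preceq> s" using r(1) t by (rule trans)
      have "A = A'"
        using f_eq_decided[OF decides_mono[OF s(2) rs] decides_check[of A'] FieldI1[OF r(1)]] r(4) by simp
      moreover have "B = graph A'"
        using f_eq_decided[OF decides_mono[OF s(3) rs] decides_check[of "graph A'"] FieldI1[OF r(1)]] r(5)
        by simp
      moreover have "r \<preceq> cl A'" using r(3,2) by (rule trans)
      ultimately show ?thesis using r(1) by blast
    qed
    have "s \<preceq> cl A" using below by (intro separative[OF FieldI1[OF s(1)]]) blast
    moreover have "B = graph A" using below refl[OF FieldI1[OF s(1)]] by blast
    ultimately show "s \<preceq> cl A \<and> B = graph A" ..
  next
    assume A: "s \<preceq> cl A \<and> B = graph A"
    show "?F a b s"
      unfolding f_mem_iff
    proof (intro allI impI)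
      fix t assume t: "t \<preceq> s"
      have "t \<preceq> t" using FieldI1[OF t] by (rule refl)
      moreover have "((check R A, check R B), t) \<in> F"
        using A trans[OF t s(1)] trans[OF t conjunct1[OF A]] by (auto simp: F_def)
      moreover have "f_pair_eq (f_eq R) (f_eq R) (a, b) (check R A, check R B) t"
        using f_eq_decided[OF decides_mono[OF s(2) t] decides_check[of A] FieldI1[OF t]]
          f_eq_decided[OF decides_mono[OF s(3) t] decides_check[of B] FieldI1[OF t]]
        by (simp add: f_pair_eq_def f_and_def)
      ultimately show "\<exists>r \<pi> u. r \<preceq> t \<and> (\<pi>, u) \<in> F \<and> r \<preceq> u \<and>
          f_pair_eq (f_eq R) (f_eq R) (a, b) \<pi> r" by blast
    qed
  qed
  have F_range: "\<exists>r. r \<preceq> s \<and> ?U a r \<and> f_baire R b r" if s: "s \<preceq> cl X'" "?F a b s" for a b s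
  proof -
    obtain r A B where r: "r \<preceq> s" "decides a A r" "decides b B r"
      using ex_decides_pair[OF FieldI1[OF s(1)]] by blast
    have rF: "r \<in> Field R" using r(1) by (rule FieldI1)
    have "?F a b r" using s(2) r(1) by (rule persistentD[OF persistent_mem])
    then have A: "r \<preceq> cl A" "B = graph A" using F_decided[OF trans[OF r(1) s(1)] r(2,3)] by blast+
    have "?U a r" using mem_U_decided[OF r(2) rF] A(1) by blast
    moreover have "f_baire R b r" using f_baire_decided[OF r(3) rF] A(2) by (auto simp: graph_def)
    ultimately show ?thesis using r(1) by blast
  qed
  have "f_function R (f_eq R) (f_eq R) ?U (f_baire R) F (cl X')"
    unfolding f_function_def Let_def
  proof (intro f_andI f_allI)
    show "f_imp R (?F a b) (?U a \<^bold>\<and> f_baire R b) (cl X')" for a b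
      unfolding f_imp_iff f_and_def using F_range by blast
    show "f_imp R (?U a) (f_ex R (?F a)) (cl X')" for a
      unfolding f_imp_iff
    proof (intro allI impI)
      fix s assume s: "s \<preceq> cl X'" "?U a s"
      obtain r A where r: "r \<preceq> s" "decides a A r" using ex_decides[OF FieldI1[OF s(1)]] by blast
      have "?U a r" using s(2) r(1) by (rule persistentD[OF persistent_mem])
      then have "r \<preceq> cl A" using mem_U_decided[OF r(2) FieldI1[OF r(1)]] by blast
      then have "?F a (check R (graph A)) r"
        using F_decided[OF trans[OF r(1) s(1)] r(2) decides_check] by blast
      then have "f_ex R (?F a) r" by (rule f_exI[rotated]) (rule persistent_mem)
      then show "\<exists>r. r \<preceq> s \<and> f_ex R (?F a) r" using r(1) by blast
    qed
    show "f_imp R (?F a b \<^bold>\<and> ?F a c) (f_eq R b c) (cl X')" for a b c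
      unfolding f_imp_iff f_and_def
    proof (intro allI impI)
      fix s assume s: "s \<preceq> cl X'" "?F a b s \<and> ?F a c s"
      obtain t A B where t: "t \<preceq> s" "decides a A t" "decides b B t"
        using ex_decides_pair[OF FieldI1[OF s(1)]] by blast
      obtain r C where r: "r \<preceq> t" "decides c C r" using ex_decides[OF FieldI1[OF t(1)]] by blast
      have rs: "r \<preceq> s" using r(1) t(1) by (rule trans)
      note rX' = trans[OF rs s(1)] and a = decides_mono[OF t(2) r(1)] and b = decides_mono[OF t(3) r(1)]
      have "?F a b r" "?F a c r"
        using persistentD[OF persistent_mem conjunct1[OF s(2)] rs]
          persistentD[OF persistent_mem conjunct2[OF s(2)] rs] by this
      then have "B = graph A" "C = graph A"
        using F_decided[OF rX' a b] F_decided[OF rX' a r(2)] by blast+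
      then have "f_eq R b c r" using f_eq_decided[OF b r(2) FieldI1[OF r(1)]] by simp
      then show "\<exists>r. r \<preceq> s \<and> f_eq R b c r" using rs by blast
    qed
  qed
  moreover have "f_imp R (f_cofinal R ?U (\<lambda>x y. f_subset R y x) (\<lambda>a. f_mem R (f_eq R) a \<X>))
      (f_cofinal R (f_baire R) (f_baire_le R) (\<lambda>b. f_ex R (\<lambda>a. f_mem R (f_eq R) a \<X> \<^bold>\<and> ?F a b)))
      (cl X')" for \<X>
    unfolding f_imp_iff[where p="cl X'"]
  proof (intro allI impI)
    let ?X = "\<lambda>a. f_mem R (f_eq R) a \<X>"
    fix s assume s: "s \<preceq> cl X'" and cof: "f_cofinal R ?U (\<lambda>x y. f_subset R y x) ?X s"
    have X_U: "\<exists>r. r \<preceq> t \<and> ?U a r" if "t \<preceq> s" "?X a t" for a t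
      using cof that unfolding f_cofinal_def f_and_def f_all_def f_imp_iff by blast
    have U_X: "\<exists>r a. r \<preceq> t \<and> ?X a r \<and> f_subset R a d r" if t: "t \<preceq> s" "?U d t" for d t
    proof -
      obtain r where r: "r \<preceq> t" "f_ex R (\<lambda>a. ?X a \<^bold>\<and> f_subset R a d) r"
        using cof t unfolding f_cofinal_def f_and_def f_all_def f_imp_iff by blast
      then obtain a u where "u \<preceq> r" "?X a u" "f_subset R a d u"
        using refl[OF FieldI1[OF r(1)]] unfolding f_ex_iff f_and_def by blast
      then show ?thesis using trans[OF _ r(1)] by blast
    qed
    have "f_cofinal R (f_baire R) (f_baire_le R) (\<lambda>b. f_ex R (\<lambda>a. ?X a \<^bold>\<and> ?F a b)) s"
      unfolding f_cofinal_def
    proof (intro f_andI f_allI)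
      show "f_imp R (f_ex R (\<lambda>a. ?X a \<^bold>\<and> ?F a b)) (f_baire R b) s" for b
        unfolding f_imp_iff
      proof (intro allI impI)
        fix t assume t: "t \<preceq> s" "f_ex R (\<lambda>a. ?X a \<^bold>\<and> ?F a b) t"
        then obtain a r where r: "r \<preceq> t" "?F a b r"
          using refl[OF FieldI1[OF t(1)]] unfolding f_ex_iff f_and_def by blast
        have "r \<preceq> cl X'" using r(1) trans[OF t(1) s] by (rule trans)
        then obtain u where "u \<preceq> r" "f_baire R b u" using F_range r(2) by blast
        then show "\<exists>r. r \<preceq> t \<and> f_baire R b r" using trans[OF _ r(1)] by blast
      qed
      show "f_imp R (f_baire R d)
          (f_ex R (\<lambda>b. f_ex R (\<lambda>a. ?X a \<^bold>\<and> ?F a b) \<^bold>\<and> f_baire_le R d b)) s" for d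
        unfolding f_imp_iff[where p=s]
      proof (intro allI impI)
        fix t assume t: "t \<preceq> s" "f_baire R d t"
        obtain t1 D where t1: "t1 \<preceq> t" "decides d D t1" using ex_decides[OF FieldI1[OF t(1)]] by blast
        have "f_baire R d t1" using t(2) t1(1) by (rule persistentD[OF persistent_baire])
        then obtain g where D: "D = range (\<lambda>m. (m, g m))"
          using f_baire_decided[OF t1(2) FieldI1[OF t1(1)]] by blast
        have t1s: "t1 \<preceq> s" using t1(1) t(1) by (rule trans)
        obtain Y where Y: "t1 = cl Y" "Y \<notin> I" "Y - X' \<in> I"
          using below_cl[OF trans[OF t1s s]] by blast
        have "Y \<inter> X' \<notin> I" using subset_Un_mem[of "Y \<inter> X'" "Y - X'" Y] Y(2,3) by blast
        then obtain Y' where Y': "Y' \<subseteq> Y \<inter> X'" "Y' \<notin> I" "g \<le> f Y'"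
          using f unfolding tukey_map_below_def by (meson inf_le2)
        have t2: "cl Y' \<preceq> t1" "cl Y' \<preceq> cl Y'" unfolding Y(1) using Y' by (auto intro: cl_mono)
        have t2s: "cl Y' \<preceq> s" using t2(1) t1s by (rule trans)
        \<comment> \<open>Cofinality is applied to \<open>Y'\<close> as a member of
          \<open>U\<close>, and yields an \<open>a\<close> in the cofinal set with \<open>a\<close>
          inside \<open>Y'\<close>.\<close>
        have "?U (check R Y') (cl Y')"
          using mem_U_decided[OF decides_check FieldI1[OF t2(2)]] t2(2) by blast
        then obtain t3 a where t3: "t3 \<preceq> cl Y'" "?X a t3" "f_subset R a (check R Y') t3"
          using U_X[OF t2s] by blast
        obtain t4 where t4: "t4 \<preceq> t3" "?U a t4" using X_U[OF trans[OF t3(1) t2s] t3(2)] by blast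
        obtain r A where r: "r \<preceq> t4" "decides a A r" using ex_decides[OF FieldI1[OF t4(1)]] by blast
        have rF: "r \<in> Field R" using r(1) by (rule FieldI1)
        have r3: "r \<preceq> t3" using r(1) t4(1) by (rule trans)
        have r1: "r \<preceq> t1" using trans[OF r3 t3(1)] t2(1) by (rule trans)
        have rX': "r \<preceq> cl X'" using trans[OF r1 t1s] s by (rule trans)
        have "?U a r" using t4(2) r(1) by (rule persistentD[OF persistent_mem])
        then have rA: "r \<preceq> cl A" using mem_U_decided[OF r(2) rF] by blast
        have "f_subset R a (check R Y') r" using t3(3) r3 by (rule persistentD[OF persistent_subset])
        then have "A \<subseteq> Y'" using f_subset_decided[OF r(2) decides_check[of Y'] rF] by simp
        \<comment> \<open>Antitonicity of \<open>f\<close> needs positivity of the smaller set; it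
          holds since \<open>r\<close> is below the classes of both \<open>A\<close> and
          \<open>X'\<close>.\<close>
        have "A \<inter> X' \<notin> I"
        proof -
          obtain W where W: "r = cl W" "W \<notin> I" "W - A \<in> I" using below_cl[OF rA] by blast
          have "W - X' \<in> I" using rX' by (simp add: W(1) R_iff)
          then have "(W - A) \<union> (W - X') \<in> I" using W(3) Un_mem by blast
          then show ?thesis using W(2) subset_Un_mem[of "A \<inter> X'" "(W - A) \<union> (W - X')" W] by blast
        qed
        then have "f Y' \<le> f (A \<inter> X')"
          using f \<open>A \<subseteq> Y'\<close> Y'(1) unfolding tukey_map_below_def by (meson inf.coboundedI1 inf.boundedE)
        then have le: "g m \<le> f (A \<inter> X') m" for m using Y'(3) by (meson le_funD order_trans)
        let ?b = "check R (graph A)"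
        have "?F a ?b r" using F_decided[OF rX' r(2) decides_check[of "graph A"]] rA by simp
        moreover have "?X a r" using t3(2) r3 by (rule persistentD[OF persistent_mem])
        ultimately have "(?X a \<^bold>\<and> ?F a ?b) r" by (intro f_andI)
        then have "f_ex R (\<lambda>a. ?X a \<^bold>\<and> ?F a ?b) r"
          by (rule f_exI[rotated]) (intro persistent_intros)
        moreover have "f_baire_le R d ?b r"
          using decides_mono[OF t1(2) r1] decides_check[of "graph A" r] le
          unfolding D graph_def by (rule f_baire_le_decided)
        ultimately have "(f_ex R (\<lambda>a. ?X a \<^bold>\<and> ?F a ?b) \<^bold>\<and> f_baire_le R d ?b) r" by (intro f_andI)
        then have "f_ex R (\<lambda>b. f_ex R (\<lambda>a. ?X a \<^bold>\<and> ?F a b) \<^bold>\<and> f_baire_le R d b) r"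
          by (rule f_exI[rotated]) (intro persistent_intros)
        moreover have "r \<preceq> t" using r1 t1(1) by (rule trans)
        ultimately show "\<exists>r. r \<preceq> t \<and>
            f_ex R (\<lambda>b. f_ex R (\<lambda>a. ?X a \<^bold>\<and> ?F a b) \<^bold>\<and> f_baire_le R d b) r" by blast
      qed
    qed
    then show "\<exists>r. r \<preceq> s \<and>
        f_cofinal R (f_baire R) (f_baire_le R) (\<lambda>b. f_ex R (\<lambda>a. ?X a \<^bold>\<and> ?F a b)) r"
      using refl[OF FieldI1[OF s]] by blast
  qed
  moreover have "cl X' \<preceq> q" unfolding X(1) using X' by (intro cl_mono)
  ultimately show "\<exists>F r. r \<preceq> q \<and>
      (f_function R (f_eq R) (f_eq R) ?U (f_baire R) F \<^bold>\<and>
       (\<^bold>\<forall>\<X>. f_imp R (f_cofinal R ?U (\<lambda>x y. f_subset R y x) (\<lambda>a. f_mem R (f_eq R) a \<X>))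
         (f_cofinal R (f_baire R) (f_baire_le R)
           (\<lambda>b. f_ex R (\<lambda>a. f_mem R (f_eq R) a \<X> \<^bold>\<and>
              f_mem R (f_pair_eq (f_eq R) (f_eq R)) (a, b) F))))) r"
    by (intro exI[of _ F] exI[of _ "cl X'"] conjI f_andI f_allI)
qed

end

lemma analytic_idealI:
  assumes "ideal_on_nat I" "analytic_family I"
  obtains h where "analytic_ideal I h"
proof -
  \<comment> \<open>Rules out the empty family in \<open>analytic_family\<close>, so a continuous
    enumeration exists.\<close>
  have "{} \<in> I" using assms(1) by (simp add: ideal_on_nat_def)
  then obtain h :: "(nat \<Rightarrow> nat) \<Rightarrow> nat \<Rightarrow> bool"
    where h: "continuous_on UNIV h" "range h = (\<lambda>A n. n \<in> A) ` I"
    using assms(2) unfolding analytic_family_def by blast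
  have "A \<in> I \<longleftrightarrow> (\<exists>x. A = {i. h x i})" for A
  proof
    assume "A \<in> I"
    then have "(\<lambda>n. n \<in> A) \<in> range h" using h(2) by blast
    then obtain x where "(\<lambda>n. n \<in> A) = h x" by blast
    then have "A = {i. h x i}" by (metis Collect_mem_eq)
    then show "\<exists>x. A = {i. h x i}" by blast
  next
    assume "\<exists>x. A = {i. h x i}"
    then obtain x where A: "A = {i. h x i}" ..
    have "h x \<in> (\<lambda>A n. n \<in> A) ` I" using h(2) by blast
    then obtain B where "h x = (\<lambda>n. n \<in> B)" "B \<in> I" by blast
    then show "A \<in> I" by (simp add: A)
  qed
  then have "analytic_ideal I h" using assms(1) h(1) by unfold_locales
  then show thesis by (rule that)
qed

theorem theorem3p9:
  fixes I :: "nat set set"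
  assumes "ideal_on_nat I"
    and "analytic_family I"
    and "adds_no_reals (quotient_forcing I)"
  shows "forced (quotient_forcing I)
           (f_ultrafilter (quotient_forcing I) (generic_ultrafilter I)
            \<^bold>\<and> f_new_family (quotient_forcing I) (generic_ultrafilter I)
            \<^bold>\<and> f_baire_tukey_le (quotient_forcing I) (generic_ultrafilter I))"
proof -
  obtain h where "analytic_ideal I h" using assms(1,2) by (rule analytic_idealI)
  then interpret analytic_ideal I h .
  interpret no_reals_ideal I by unfold_locales (rule assms(3))
  \<comment> \<open>Analyticity gives \<open>split_positive\<close> and \<open>ex_tukey_map\<close>;
    the hypothesis of the latter is \<open>distributive\<close>, which comes from the absence of new
    reals.\<close>
  show ?thesis
    unfolding forced_def
    by (intro ballI f_andI forces_ultrafilter forces_new_family split_positive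
        forces_baire_tukey_le ex_tukey_map distributive)
qed

end
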